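(* In the setting of the context, let $K_0\in\mathcal{D}_{\mathrm{stab}}$, $\beta,\tau\in(0,1)$, $\eta_0>0$, and let $\{K_k\}_{k\ge0}$ be generated by the adjoint gradient descent algorithm with backtracking Armijo line search: for each $k\ge0$, $\eta_k$ is the first element $\eta$ of the sequence $\eta_0,\beta\eta_0,\beta^2\eta_0,\dots$ such that $$J_\mu\big(K_k-\eta\nabla J_\mu(K_k)\big)\le J_\mu(K_k)-\tau\eta\,\|\nabla J_\mu(K_k)\|_F^2,$$ and $K_{k+1}=K_k-\eta_k\nabla J_\mu(K_k)$. Let $\mathcal{S}_0=\{K\in\mathbb{R}^{m\times n}: J_\mu(K)\le J_\mu(K_0)\}$. Then there exists $\eta_{\min}>0$ such that: (1) all iterates satisfy $K_k\in\mathcal{S}_0\subset\mathcal{D}_{\mathrm{stab}}$ for all $k\ge0$; (2) the step sizes satisfy $\eta_k\ge\eta_{\min}>0$ for all $k\ge0$; (3) $\lim_{k\to\infty}\|\nabla J_\mu(K_k)\|_F=0$. Furthermore, for every $N\ge0$, $$\min_{0\le k\le N}\|\nabla J_\mu(K_k)\|_F^2\le\frac{J_\mu(K_0)-\inf_{K\in\mathcal{S}_0}J_\mu(K)}{\tau\,\eta_{\min}\,(N+1)},$$ so that the left-hand side is $O(1/N)$.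
   Context: Let $A\in\mathbb{R}^{n\times n}$, $B\in\mathbb{R}^{n\times m}$; $Q\in\mathbb{R}^{n\times n}$, $R\in\mathbb{R}^{m\times m}$, $\Sigma\in\mathbb{R}^{n\times n}$ symmetric positive definite; $x\in\mathbb{R}^n$; $\gamma\in(0,1)$; $\alpha\ge0$; $\mu>0$. Write $A_K=A+BK$ and $\mathcal{D}_{\mathrm{stab}}=\{K\in\mathbb{R}^{m\times n}:\rho(A_K)<1\}$ ($\rho$ = spectral radius). For $K\in\mathcal{D}_{\mathrm{stab}}$ let $P=P(K)$, $Z=Z(K)$, $\widetilde P=\widetilde P(K)$ be the unique solutions of $$P-\gamma A_K^\top PA_K=Q+K^\top RK,\quad Z-\gamma^2A_KZA_K^\top=A_K\Big(xx^\top+\tfrac{\gamma^2}{1-\gamma^2}\Sigma\Big)A_K^\top,\quad \widetilde P-A_K^\top\widetilde PA_K=I.$$ The mean-variance objective is $$J(K)=x^\top Px+b\operatorname{tr}(P\Sigma)+c\operatorname{tr}(P\Sigma P\Sigma)+d\operatorname{tr}(P\Sigma PZ),\qquad b=\tfrac{\gamma}{1-\gamma},\ c=\tfrac{2\alpha\gamma^2}{1-\gamma^2},\ d=4\alpha\gamma^2,$$ and the penalized objective is $J_\mu(K)=J(K)+\mu\log\det\widetilde P(K)$ for $K\in\mathcal{D}_{\mathrm{stab}}$, with $J_\mu(K)=+\infty$ for $K\notin\mathcal{D}_{\mathrm{stab}}$. $\nabla J_\mu$ is the gradient with respect to $K$ for the Frobenius inner product, and $\|\cdot\|_F$ is the Frobenius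 norm. *)

theory Defs
  imports "HOL-Analysis.Analysis" "HOL-Library.Landau_Symbols"
begin

definition pos_def :: "real ^ 'n ^ 'n \<Rightarrow> bool" where
  "pos_def M \<longleftrightarrow> transpose M = M \<and> (\<forall>v. v \<noteq> 0 \<longrightarrow> v \<bullet> (M *v v) > 0)"

text \<open>The eigenvalues of a real matrix are taken in the complex numbers.\<close>

definition eigenvalues :: "real ^ 'n ^ 'n \<Rightarrow> complex set" where
  "eigenvalues M =
     {l. \<exists>v. v \<noteq> 0 \<and> map_matrix complex_of_real M *v v = l *s v}"

definition spectral_radius :: "real ^ 'n ^ 'n \<Rightarrow> real" where
  "spectral_radius M = Max (cmod ` eigenvalues M)"

definition outer :: "real ^ 'n \<Rightarrow> real ^ 'n ^ 'n" where
  "outer x = (\<chi> i j. x $ i * x $ j)"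

definition closed_loop ::
  "real ^ 'n ^ 'n \<Rightarrow> real ^ 'm ^ 'n \<Rightarrow> real ^ 'n ^ 'm \<Rightarrow> real ^ 'n ^ 'n" where
  "closed_loop A B K = A + B ** K"

definition D_stab :: "real ^ 'n ^ 'n \<Rightarrow> real ^ 'm ^ 'n \<Rightarrow> (real ^ 'n ^ 'm) set" where
  "D_stab A B = {K. spectral_radius (closed_loop A B K) < 1}"

text \<open>The following three matrix equations are uniquely solvable for \<open>K \<in> D_stab A B\<close>
  and \<open>0 < \<gamma> < 1\<close>; outside \<open>D_stab A B\<close> the three values are never used.\<close>

definition P_sol ::
  "real ^ 'n ^ 'n \<Rightarrow> real ^ 'm ^ 'n \<Rightarrow> real ^ 'n ^ 'n \<Rightarrow> real ^ 'm ^ 'm \<Rightarrow> real \<Rightarrow>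
   real ^ 'n ^ 'm \<Rightarrow> real ^ 'n ^ 'n" where
  "P_sol A B Q R \<gamma> K = (THE P.
     P - \<gamma> *\<^sub>R (transpose (closed_loop A B K) ** P ** closed_loop A B K)
       = Q + transpose K ** R ** K)"

definition Z_sol ::
  "real ^ 'n ^ 'n \<Rightarrow> real ^ 'm ^ 'n \<Rightarrow> real ^ 'n ^ 'n \<Rightarrow> real ^ 'n \<Rightarrow> real \<Rightarrow>
   real ^ 'n ^ 'm \<Rightarrow> real ^ 'n ^ 'n" where
  "Z_sol A B \<Sigma> x \<gamma> K = (THE Z.
     Z - \<gamma>\<^sup>2 *\<^sub>R (closed_loop A B K ** Z ** transpose (closed_loop A B K))
       = closed_loop A B K ** (outer x + (\<gamma>\<^sup>2 / (1 - \<gamma>\<^sup>2)) *\<^sub>R \<Sigma>)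
           ** transpose (closed_loop A B K))"

definition Pt_sol ::
  "real ^ 'n ^ 'n \<Rightarrow> real ^ 'm ^ 'n \<Rightarrow> real ^ 'n ^ 'm \<Rightarrow> real ^ 'n ^ 'n" where
  "Pt_sol A B K = (THE P.
     P - transpose (closed_loop A B K) ** P ** closed_loop A B K = mat 1)"

definition J ::
  "real ^ 'n ^ 'n \<Rightarrow> real ^ 'm ^ 'n \<Rightarrow> real ^ 'n ^ 'n \<Rightarrow> real ^ 'm ^ 'm \<Rightarrow> real ^ 'n ^ 'n \<Rightarrow>
   real ^ 'n \<Rightarrow> real \<Rightarrow> real \<Rightarrow> real ^ 'n ^ 'm \<Rightarrow> real" where
  "J A B Q R \<Sigma> x \<gamma> \<alpha> K =
     (let P = P_sol A B Q R \<gamma> K;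
          Z = Z_sol A B \<Sigma> x \<gamma> K;
          b = \<gamma> / (1 - \<gamma>);
          c = 2 * \<alpha> * \<gamma>\<^sup>2 / (1 - \<gamma>\<^sup>2);
          d = 4 * \<alpha> * \<gamma>\<^sup>2
      in x \<bullet> (P *v x) + b * trace (P ** \<Sigma>) + c * trace (P ** \<Sigma> ** P ** \<Sigma>)
           + d * trace (P ** \<Sigma> ** P ** Z))"

definition J_pen ::
  "real ^ 'n ^ 'n \<Rightarrow> real ^ 'm ^ 'n \<Rightarrow> real ^ 'n ^ 'n \<Rightarrow> real ^ 'm ^ 'm \<Rightarrow> real ^ 'n ^ 'n \<Rightarrow>
   real ^ 'n \<Rightarrow> real \<Rightarrow> real \<Rightarrow> real \<Rightarrow> real ^ 'n ^ 'm \<Rightarrow> ereal" where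
  "J_pen A B Q R \<Sigma> x \<gamma> \<alpha> \<mu> K =
     (if K \<in> D_stab A B
      then ereal (J A B Q R \<Sigma> x \<gamma> \<alpha> K + \<mu> * ln (det (Pt_sol A B K)))
      else \<infinity>)"

text \<open>On \<open>real ^ 'n ^ 'm\<close>, \<open>(\<bullet>)\<close> is the Frobenius inner product and \<open>norm\<close> is the Frobenius norm,
  so \<open>GDERIV\<close> gives the Frobenius gradient.\<close>

definition gradient :: "('a::real_inner \<Rightarrow> real) \<Rightarrow> 'a \<Rightarrow> 'a" where
  "gradient f x = (THE D. GDERIV f x :> D)"

text \<open>Since \<open>D_stab A B\<close> is open, the gradient at a point of it does not depend on the value
  that \<open>real_of_ereal\<close> assigns to \<open>\<infinity>\<close>.\<close>

definition grad_J_pen ::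
  "real ^ 'n ^ 'n \<Rightarrow> real ^ 'm ^ 'n \<Rightarrow> real ^ 'n ^ 'n \<Rightarrow> real ^ 'm ^ 'm \<Rightarrow> real ^ 'n ^ 'n \<Rightarrow>
   real ^ 'n \<Rightarrow> real \<Rightarrow> real \<Rightarrow> real \<Rightarrow> real ^ 'n ^ 'm \<Rightarrow> real ^ 'n ^ 'm" where
  "grad_J_pen A B Q R \<Sigma> x \<gamma> \<alpha> \<mu> K =
     gradient (\<lambda>L. real_of_ereal (J_pen A B Q R \<Sigma> x \<gamma> \<alpha> \<mu> L)) K"

definition armijo ::
  "('a::real_normed_vector \<Rightarrow> ereal) \<Rightarrow> ('a \<Rightarrow> 'a) \<Rightarrow> real \<Rightarrow> 'a \<Rightarrow> real \<Rightarrow> bool" where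
  "armijo f g \<tau> K \<eta> \<longleftrightarrow> f (K - \<eta> *\<^sub>R g K) \<le> f K - ereal (\<tau> * \<eta> * (norm (g K))\<^sup>2)"

text \<open>If no trial step is accepted, \<open>backtrack\<close> is unspecified; that some trial step is accepted
  therefore has to be claimed separately.\<close>

definition backtrack ::
  "('a::real_normed_vector \<Rightarrow> ereal) \<Rightarrow> ('a \<Rightarrow> 'a) \<Rightarrow> real \<Rightarrow> real \<Rightarrow> real \<Rightarrow> 'a \<Rightarrow> real" where
  "backtrack f g \<tau> \<eta>\<^sub>0 \<beta> K = \<eta>\<^sub>0 * \<beta> ^ (LEAST j. armijo f g \<tau> K (\<eta>\<^sub>0 * \<beta> ^ j))"

end

theory Submission
  imports Defs "HOL-Computational_Algebra.Fundamental_Theorem_Algebra"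
begin

text \<open>The sublevel set \<open>S\<^sub>0\<close> is compact. The cost dominates a multiple of \<open>(norm K)\<^sup>2\<close>, and
  \<open>Pt_sol \<ge> I\<close> makes the determinant of \<open>Pt_sol\<close> dominate its diagonal entries, so the
  log-determinant term bounds \<open>Pt_sol\<close>; a limit of gains with bounded \<open>Pt_sol\<close> still has a
  Lyapunov certificate and is therefore stabilizing.
  On the open set \<open>D_stab\<close> the objective is composed of rational functions (Cramer's rule for
  the matrix equations) and \<open>ln\<close>, so its first-order Taylor remainder is locally uniformly
  quadratic, and by compactness \<open>\<bar>f (K + h) - f K - G K \<bullet> h\<bar> \<le> C (norm h)\<^sup>2\<close> for all \<open>K \<in> S\<^sub>0\<close> and
  \<open>norm h < d\<close>. Hence every sufficiently small step passes the Armijo test, which bounds the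
  accepted steps from below, and telescoping the Armijo inequality yields the rate.\<close>

text \<open>The cost alone does not confine the iterates. The equations for P and Z are discounted
  by \<gamma> and \<gamma>^2, hence still solvable on and slightly beyond the boundary of the stable
  region, so J stays bounded near such a point. Only the undiscounted \<open>Pt_sol\<close> detects
  the boundary, and it enters the objective through a determinant. The condition that the spectral
  radius is below 1 is not closed, so limits are taken of pairs (K, P) subject to the Lyapunov
  equation and P \<ge> I, which are closed conditions. The spectral radius is therefore used through
  two bridges: if it is below 1 then the orbits F^k v tend to 0, which makes the Stein equations
  uniquely solvable and order preserving; conversely, a Lyapunov certificate forces it below 1. Both
  bridges, and the determinant and trace inequalities, are reached by elementary elimination,
  without Jordan forms or diagonalization.\<close>

section \<open>Functions with a locally uniform quadratic Taylor remainder\<close>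

text \<open>Both points of the pair \<open>p\<close> vary near \<open>a\<close>; this makes the remainder bound uniform over compact
  sets and stands in for a locally Lipschitz gradient.\<close>

definition C11_at :: "('a::real_inner \<Rightarrow> real) \<Rightarrow> 'a \<Rightarrow> bool" where
  "C11_at f a \<longleftrightarrow> (\<exists>g C. \<forall>\<^sub>F p in nhds (a, a). \<bar>f (fst p)\<bar> \<le> C \<and> norm (g (fst p)) \<le> C \<and>
     \<bar>f (snd p) - f (fst p) - g (fst p) \<bullet> (snd p - fst p)\<bar> \<le> C * (norm (snd p - fst p))\<^sup>2)"

text \<open>The definition has one constant for all three bounds; here each bound may come with its
  own, since the sum of the absolute values dominates all of them.\<close>

lemma C11_atI:
  assumes "\<forall>\<^sub>F p in nhds (a, a). \<bar>f (fst p)\<bar> \<le> C"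
    and "\<forall>\<^sub>F p in nhds (a, a). norm (g (fst p)) \<le> D"
    and "\<forall>\<^sub>F p in nhds (a, a). \<bar>f (snd p) - f (fst p) - g (fst p) \<bullet> (snd p - fst p)\<bar> \<le> E * (norm (snd p - fst p))\<^sup>2"
  shows "C11_at f a"
proof -
  let ?M = "\<bar>C\<bar> + \<bar>D\<bar> + \<bar>E\<bar>"
  have "\<forall>\<^sub>F p in nhds (a, a). \<bar>f (fst p)\<bar> \<le> ?M \<and> norm (g (fst p)) \<le> ?M \<and>
     \<bar>f (snd p) - f (fst p) - g (fst p) \<bullet> (snd p - fst p)\<bar> \<le> ?M * (norm (snd p - fst p))\<^sup>2"
    using assms
  proof eventually_elim
    case (elim p)
    have "E * (norm (snd p - fst p))\<^sup>2 \<le> ?M * (norm (snd p - fst p))\<^sup>2"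
      by (rule mult_right_mono) auto
    then show ?case using elim by linarith
  qed
  then show ?thesis unfolding C11_at_def by blast
qed

lemma eventually_nhds_fst:
  assumes "\<forall>\<^sub>F x in nhds a. P x" shows "\<forall>\<^sub>F p in nhds (a, b). P (fst p)"
  unfolding nhds_prod by (rule eventually_compose_filterlim[OF assms filterlim_fst])

lemma eventually_nhds_snd:
  assumes "\<forall>\<^sub>F x in nhds b. P x" shows "\<forall>\<^sub>F p in nhds (a, b). P (snd p)"
  unfolding nhds_prod by (rule eventually_compose_filterlim[OF assms filterlim_snd])

lemma eventually_nhds_norm_diff_less_1:
  fixes a :: "'a::real_normed_vector"
  shows "\<forall>\<^sub>F p in nhds (a, a). norm (snd p - fst p) < 1"
proof -
  have "((\<lambda>p. norm (snd p - fst p)) \<longlongrightarrow> norm (snd (a, a) - fst (a, a))) (nhds (a, a))"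
    by (intro tendsto_intros filterlim_ident)
  then show ?thesis by (auto simp: order_tendsto_iff)
qed

text \<open>For points at distance less than 1 the quadratic remainder is at most linear; adding the
  Cauchy-Schwarz bound on the linear part gives twice the constant.\<close>

lemma C11_at_lipschitz:
  assumes "C11_at f a"
  obtains C where "C \<ge> 0" "\<forall>\<^sub>F p in nhds (a, a). \<bar>f (fst p)\<bar> \<le> C \<and> \<bar>f (snd p) - f (fst p)\<bar> \<le> C * norm (snd p - fst p)"
proof -
  obtain g C where C: "\<forall>\<^sub>F p in nhds (a, a). \<bar>f (fst p)\<bar> \<le> C \<and> norm (g (fst p)) \<le> C \<and>
     \<bar>f (snd p) - f (fst p) - g (fst p) \<bullet> (snd p - fst p)\<bar> \<le> C * (norm (snd p - fst p))\<^sup>2"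
    using assms unfolding C11_at_def by blast
  \<comment> \<open>\<open>nhds (a, a)\<close> contains the point itself, so the bounds hold at
    \<open>a\<close> and \<bar>f a\<bar> \<le> C gives the sign.\<close>
  have "C \<ge> 0" using eventually_nhds_x_imp_x[OF C] by auto
  have "\<forall>\<^sub>F p in nhds (a, a). \<bar>f (fst p)\<bar> \<le> 2 * C \<and> \<bar>f (snd p) - f (fst p)\<bar> \<le> 2 * C * norm (snd p - fst p)"
    using C eventually_nhds_norm_diff_less_1[of a]
  proof eventually_elim
    case (elim p)
    let ?h = "norm (snd p - fst p)"
    have "\<bar>g (fst p) \<bullet> (snd p - fst p)\<bar> \<le> norm (g (fst p)) * ?h"
      by (rule Cauchy_Schwarz_ineq2)
    also have "\<dots> \<le> C * ?h" using elim by (intro mult_right_mono) auto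
    finally have 1: "\<bar>g (fst p) \<bullet> (snd p - fst p)\<bar> \<le> C * ?h" .
    have "C * ?h\<^sup>2 \<le> C * ?h" using elim \<open>C \<ge> 0\<close>
      by (intro mult_left_mono) (auto simp: power2_eq_square mult_left_le)
    then show ?case using elim 1 \<open>C \<ge> 0\<close> by auto
  qed
  then show ?thesis using that[of "2*C"] \<open>C \<ge> 0\<close> by auto
qed

lemma C11_at_isCont:
  assumes "C11_at f a" shows "isCont f a"
proof -
  obtain C where "C \<ge> 0" and C: "\<forall>\<^sub>F p in nhds (a, a). \<bar>f (fst p)\<bar> \<le> C \<and> \<bar>f (snd p) - f (fst p)\<bar> \<le> C * norm (snd p - fst p)"
    by (rule C11_at_lipschitz[OF assms])
  have "((\<lambda>y. (a, y)) \<longlongrightarrow> (a, a)) (at a)" by (intro tendsto_intros filterlim_ident)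
  from eventually_compose_filterlim[OF C this]
  have "\<forall>\<^sub>F y in at a. norm (f y - f a) \<le> C * norm (y - a)"
    by eventually_elim simp
  moreover have "((\<lambda>y. C * norm (y - a)) \<longlongrightarrow> C * norm (a - a)) (at a)"
    by (intro tendsto_intros filterlim_ident)
  then have "((\<lambda>y. C * norm (y - a)) \<longlongrightarrow> 0) (at a)" by simp
  ultimately have "((\<lambda>y. f y - f a) \<longlongrightarrow> 0) (at a)"
    by (rule Lim_null_comparison)
  then show ?thesis by (simp add: isCont_def LIM_zero_iff)
qed

section \<open>Closure of the remainder class under arithmetic and composition\<close>

lemma C11_at_const: "C11_at (\<lambda>x. c) a"
  by (rule C11_atI[where g = "\<lambda>x. 0" and C = "\<bar>c\<bar>" and D = 0 and E = 0]) auto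

lemma C11_at_inner: "C11_at (\<lambda>x. c \<bullet> x) a"
proof (rule C11_atI[where g = "\<lambda>x. c" and C = "\<bar>c \<bullet> a\<bar> + 1" and D = "norm c" and E = 0])
  have "((\<lambda>p. \<bar>c \<bullet> fst p\<bar>) \<longlongrightarrow> \<bar>c \<bullet> fst (a, a)\<bar>) (nhds (a, a))"
    by (intro tendsto_intros filterlim_ident)
  then have "\<forall>\<^sub>F p in nhds (a, a). \<bar>c \<bullet> fst p\<bar> < \<bar>c \<bullet> a\<bar> + 1"
    by (auto simp: order_tendsto_iff)
  then show "\<forall>\<^sub>F p in nhds (a, a). \<bar>c \<bullet> fst p\<bar> \<le> \<bar>c \<bullet> a\<bar> + 1"
    by eventually_elim auto
qed (auto simp: inner_diff_right)

lemma C11_at_add: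
  assumes "C11_at f a" "C11_at g a" shows "C11_at (\<lambda>x. f x + g x) a"
proof -
  obtain f' C where f: "\<forall>\<^sub>F p in nhds (a, a). \<bar>f (fst p)\<bar> \<le> C \<and> norm (f' (fst p)) \<le> C \<and>
     \<bar>f (snd p) - f (fst p) - f' (fst p) \<bullet> (snd p - fst p)\<bar> \<le> C * (norm (snd p - fst p))\<^sup>2"
    using assms unfolding C11_at_def by blast
  obtain g' D where g: "\<forall>\<^sub>F p in nhds (a, a). \<bar>g (fst p)\<bar> \<le> D \<and> norm (g' (fst p)) \<le> D \<and>
     \<bar>g (snd p) - g (fst p) - g' (fst p) \<bullet> (snd p - fst p)\<bar> \<le> D * (norm (snd p - fst p))\<^sup>2"
    using assms unfolding C11_at_def by blast
  show ?thesis
  proof (rule C11_atI[where g = "\<lambda>x. f' x + g' x" and C = "C + D" and D = "C + D" and E = "C + D"])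
    show "\<forall>\<^sub>F p in nhds (a, a). \<bar>f (fst p) + g (fst p)\<bar> \<le> C + D"
      using f g by eventually_elim auto
    show "\<forall>\<^sub>F p in nhds (a, a). norm (f' (fst p) + g' (fst p)) \<le> C + D"
      using f g by eventually_elim (auto intro: norm_add_rule_thm)
    show "\<forall>\<^sub>F p in nhds (a, a). \<bar>(f (snd p) + g (snd p)) - (f (fst p) + g (fst p)) - (f' (fst p) + g' (fst p)) \<bullet> (snd p - fst p)\<bar>
      \<le> (C + D) * (norm (snd p - fst p))\<^sup>2"
      using f g
    proof eventually_elim
      case (elim p)
      then show ?case by (auto simp: inner_add_left distrib_right)
    qed
  qed
qed

lemma C11_at_mult:
  assumes "C11_at f a" "C11_at g a" shows "C11_at (\<lambda>x. f x * g x) a"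
proof -
  obtain f' C where f: "\<forall>\<^sub>F p in nhds (a, a). \<bar>f (fst p)\<bar> \<le> C \<and> norm (f' (fst p)) \<le> C \<and>
     \<bar>f (snd p) - f (fst p) - f' (fst p) \<bullet> (snd p - fst p)\<bar> \<le> C * (norm (snd p - fst p))\<^sup>2"
    using assms unfolding C11_at_def by blast
  obtain g' D where g: "\<forall>\<^sub>F p in nhds (a, a). \<bar>g (fst p)\<bar> \<le> D \<and> norm (g' (fst p)) \<le> D \<and>
     \<bar>g (snd p) - g (fst p) - g' (fst p) \<bullet> (snd p - fst p)\<bar> \<le> D * (norm (snd p - fst p))\<^sup>2"
    using assms unfolding C11_at_def by blast
  obtain C2 where C2: "C2 \<ge> 0" "\<forall>\<^sub>F p in nhds (a, a). \<bar>f (fst p)\<bar> \<le> C2 \<and> \<bar>f (snd p) - f (fst p)\<bar> \<le> C2 * norm (snd p - fst p)"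
    by (rule C11_at_lipschitz[OF assms(1)])
  obtain D2 where D2: "D2 \<ge> 0" "\<forall>\<^sub>F p in nhds (a, a). \<bar>g (fst p)\<bar> \<le> D2 \<and> \<bar>g (snd p) - g (fst p)\<bar> \<le> D2 * norm (snd p - fst p)"
    by (rule C11_at_lipschitz[OF assms(2)])
  have nn: "C \<ge> 0" "D \<ge> 0" using eventually_nhds_x_imp_x[OF f] eventually_nhds_x_imp_x[OF g] by auto
  show ?thesis
  proof (rule C11_atI[where g = "\<lambda>x. g x *\<^sub>R f' x + f x *\<^sub>R g' x" and C = "C * D" and D = "D * C + C * D" and E = "C * D + C * D + C2 * D2"])
    show "\<forall>\<^sub>F p in nhds (a, a). \<bar>f (fst p) * g (fst p)\<bar> \<le> C * D"
      using f g by eventually_elim (auto simp: abs_mult intro!: mult_mono nn)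
    show "\<forall>\<^sub>F p in nhds (a, a). norm (g (fst p) *\<^sub>R f' (fst p) + f (fst p) *\<^sub>R g' (fst p)) \<le> D * C + C * D"
      using f g by eventually_elim (rule norm_add_rule_thm, auto intro!: mult_mono nn)
    show "\<forall>\<^sub>F p in nhds (a, a). \<bar>f (snd p) * g (snd p) - f (fst p) * g (fst p) -
        (g (fst p) *\<^sub>R f' (fst p) + f (fst p) *\<^sub>R g' (fst p)) \<bullet> (snd p - fst p)\<bar>
      \<le> (C * D + C * D + C2 * D2) * (norm (snd p - fst p))\<^sup>2"
      using f g C2(2) D2(2)
    proof eventually_elim
      case (elim p)
      let ?h = "norm (snd p - fst p)"
      let ?rf = "f (snd p) - f (fst p) - f' (fst p) \<bullet> (snd p - fst p)"
      let ?rg = "g (snd p) - g (fst p) - g' (fst p) \<bullet> (snd p - fst p)"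
      have "\<bar>?rf * g (fst p)\<bar> \<le> (C * ?h\<^sup>2) * D"
        unfolding abs_mult using elim nn by (intro mult_mono) auto
      moreover have "\<bar>f (fst p) * ?rg\<bar> \<le> C * (D * ?h\<^sup>2)"
        unfolding abs_mult using elim nn by (intro mult_mono) auto
      moreover have "\<bar>(f (snd p) - f (fst p)) * (g (snd p) - g (fst p))\<bar> \<le> (C2 * ?h) * (D2 * ?h)"
        unfolding abs_mult using elim C2(1) D2(1) by (intro mult_mono) auto
      \<comment> \<open>The remainder of a product consists of the two weighted remainders and the
        product of the two increments; the latter is quadratic by the local Lipschitz bounds, whence
        the term \<open>C2 * D2\<close>.\<close>
      moreover have "f (snd p) * g (snd p) - f (fst p) * g (fst p) -
        (g (fst p) *\<^sub>R f' (fst p) + f (fst p) *\<^sub>R g' (fst p)) \<bullet> (snd p - fst p)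
        = ?rf * g (fst p) + f (fst p) * ?rg + (f (snd p) - f (fst p)) * (g (snd p) - g (fst p))"
        by (simp add: algebra_simps inner_add_left)
      ultimately show ?case by (simp add: algebra_simps power2_eq_square)
    qed
  qed
qed

lemma C11_at_compose:
  fixes \<phi> :: "real \<Rightarrow> real"
  assumes "C11_at f a" "C11_at \<phi> (f a)" shows "C11_at (\<lambda>x. \<phi> (f x)) a"
proof -
  obtain f' C where f: "\<forall>\<^sub>F p in nhds (a, a). \<bar>f (fst p)\<bar> \<le> C \<and> norm (f' (fst p)) \<le> C \<and>
     \<bar>f (snd p) - f (fst p) - f' (fst p) \<bullet> (snd p - fst p)\<bar> \<le> C * (norm (snd p - fst p))\<^sup>2"
    using assms unfolding C11_at_def by blast
  obtain g' D where g: "\<forall>\<^sub>F p in nhds (f a, f a). \<bar>\<phi> (fst p)\<bar> \<le> D \<and> norm (g' (fst p)) \<le> D \<and>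
     \<bar>\<phi> (snd p) - \<phi> (fst p) - g' (fst p) \<bullet> (snd p - fst p)\<bar> \<le> D * (norm (snd p - fst p))\<^sup>2"
    using assms unfolding C11_at_def by blast
  obtain C2 where C2: "C2 \<ge> 0" "\<forall>\<^sub>F p in nhds (a, a). \<bar>f (fst p)\<bar> \<le> C2 \<and> \<bar>f (snd p) - f (fst p)\<bar> \<le> C2 * norm (snd p - fst p)"
    by (rule C11_at_lipschitz[OF assms(1)])
  have nn: "C \<ge> 0" "D \<ge> 0" using eventually_nhds_x_imp_x[OF f] eventually_nhds_x_imp_x[OF g] by auto
  have c: "(f \<longlongrightarrow> f a) (nhds a)"
    using C11_at_isCont[OF assms(1)] unfolding isCont_def by (rule tendsto_at_iff_tendsto_nhds[THEN iffD1])
  have c1: "((\<lambda>p. f (fst p)) \<longlongrightarrow> f a) (nhds (a, a))"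
    unfolding nhds_prod by (rule filterlim_compose[OF c filterlim_fst])
  have c2: "((\<lambda>p. f (snd p)) \<longlongrightarrow> f a) (nhds (a, a))"
    unfolding nhds_prod by (rule filterlim_compose[OF c filterlim_snd])
  have "((\<lambda>p. (f (fst p), f (snd p))) \<longlongrightarrow> (f a, f a)) (nhds (a, a))"
    by (rule tendsto_Pair[OF c1 c2])
  from eventually_compose_filterlim[OF g this] have g2: "\<forall>\<^sub>F p in nhds (a, a). \<bar>\<phi> (f (fst p))\<bar> \<le> D \<and> norm (g' (f (fst p))) \<le> D \<and>
     \<bar>\<phi> (f (snd p)) - \<phi> (f (fst p)) - g' (f (fst p)) * (f (snd p) - f (fst p))\<bar> \<le> D * (f (snd p) - f (fst p))\<^sup>2"
    by simp
  show ?thesis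
  proof (rule C11_atI[where g = "\<lambda>x. g' (f x) *\<^sub>R f' x" and C = D and D = "D * C" and E = "D * C2\<^sup>2 + D * C"])
    show "\<forall>\<^sub>F p in nhds (a, a). \<bar>\<phi> (f (fst p))\<bar> \<le> D"
      using g2 by eventually_elim auto
    show "\<forall>\<^sub>F p in nhds (a, a). norm (g' (f (fst p)) *\<^sub>R f' (fst p)) \<le> D * C"
      using f g2 by eventually_elim (auto intro!: mult_mono nn)
    show "\<forall>\<^sub>F p in nhds (a, a). \<bar>\<phi> (f (snd p)) - \<phi> (f (fst p)) -
        (g' (f (fst p)) *\<^sub>R f' (fst p)) \<bullet> (snd p - fst p)\<bar>
      \<le> (D * C2\<^sup>2 + D * C) * (norm (snd p - fst p))\<^sup>2"
      using f g2 C2(2)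
    proof eventually_elim
      case (elim p)
      let ?h = "norm (snd p - fst p)"
      let ?rf = "f (snd p) - f (fst p) - f' (fst p) \<bullet> (snd p - fst p)"
      let ?rg = "\<phi> (f (snd p)) - \<phi> (f (fst p)) - g' (f (fst p)) * (f (snd p) - f (fst p))"
      have "\<bar>g' (f (fst p)) * ?rf\<bar> \<le> D * (C * ?h\<^sup>2)"
        unfolding abs_mult using elim nn by (intro mult_mono) auto
      moreover have "(f (snd p) - f (fst p))\<^sup>2 \<le> (C2 * ?h)\<^sup>2"
        using elim by (intro power2_le_iff_abs_le[THEN iffD2]) (auto simp: C2(1))
      then have "D * (f (snd p) - f (fst p))\<^sup>2 \<le> D * (C2 * ?h)\<^sup>2"
        using nn by (intro mult_left_mono) auto
      then have "\<bar>?rg\<bar> \<le> D * (C2 * ?h)\<^sup>2" using elim by linarith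
      \<comment> \<open>The outer remainder is quadratic in the increment of \<open>f\<close>, which
        is at most \<open>C2\<close> times the distance; the inner remainder is multiplied by the
        outer derivative.\<close>
      moreover have "\<phi> (f (snd p)) - \<phi> (f (fst p)) -
        (g' (f (fst p)) *\<^sub>R f' (fst p)) \<bullet> (snd p - fst p) = ?rg + g' (f (fst p)) * ?rf"
        by (simp add: algebra_simps)
      ultimately show ?case by (simp add: algebra_simps power2_eq_square)
    qed
  qed
qed

lemma C11_at_inverse_real:
  fixes t :: real
  assumes "t \<noteq> 0" shows "C11_at inverse t"
proof -
  define m where "m = \<bar>t\<bar> / 2"
  have "((\<lambda>x. \<bar>x\<bar>) \<longlongrightarrow> \<bar>t\<bar>) (nhds t)" by (intro tendsto_intros filterlim_ident)
  then have e: "\<forall>\<^sub>F x in nhds t. m < \<bar>x\<bar>"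
    using assms by (auto dest: order_tendstoD(1)[of _ _ _ m] simp: m_def)
  have m: "m > 0" using assms by (simp add: m_def)
  show ?thesis
  proof (rule C11_atI[where g = "\<lambda>x. - (inverse x)\<^sup>2" and C = "inverse m" and D = "(inverse m)\<^sup>2" and E = "inverse m ^ 3"])
    show "\<forall>\<^sub>F p in nhds (t, t). \<bar>inverse (fst p)\<bar> \<le> inverse m"
      using eventually_nhds_fst[OF e]
      by eventually_elim (use m in \<open>auto simp: abs_inverse intro!: le_imp_inverse_le\<close>)
    show "\<forall>\<^sub>F p in nhds (t, t). norm (- (inverse (fst p))\<^sup>2) \<le> (inverse m)\<^sup>2"
      using eventually_nhds_fst[OF e]
    proof eventually_elim
      case (elim p)
      then have "\<bar>inverse (fst p)\<bar> \<le> inverse m" using m by (auto simp: abs_inverse intro!: le_imp_inverse_le)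
      from power_mono[OF this, of 2] show ?case by (simp del: abs_inverse)
    qed
    show "\<forall>\<^sub>F p in nhds (t, t). \<bar>inverse (snd p) - inverse (fst p) - (- (inverse (fst p))\<^sup>2) \<bullet> (snd p - fst p)\<bar>
      \<le> inverse m ^ 3 * (norm (snd p - fst p))\<^sup>2"
      using eventually_nhds_fst[OF e, of t] eventually_nhds_snd[OF e, of t]
    proof eventually_elim
      case (elim p)
      define x y where "x = fst p" and "y = snd p"
      have nz: "x \<noteq> 0" "y \<noteq> 0" using elim m by (auto simp: x_def y_def)
      have i: "\<bar>inverse x\<bar> \<le> inverse m" "\<bar>inverse y\<bar> \<le> inverse m"
        using elim m by (auto simp: abs_inverse x_def y_def intro!: le_imp_inverse_le)
      \<comment> \<open>The remainder of the reciprocal is exactly (y - x)^2 / (x^2 y), and both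
        points stay at distance at least \<open>m\<close> from 0.\<close>
      have "inverse y - inverse x - (- (inverse x)\<^sup>2) * (y - x) = (inverse x * inverse x * inverse y) * (y - x)\<^sup>2"
        using nz by (simp add: field_simps power2_eq_square)
      moreover have "\<bar>inverse x * inverse x * inverse y\<bar> \<le> inverse m * inverse m * inverse m"
        unfolding abs_mult using i m by (intro mult_mono) auto
      then have "\<bar>inverse x * inverse x * inverse y\<bar> * (y - x)\<^sup>2 \<le> inverse m ^ 3 * (y - x)\<^sup>2"
        by (intro mult_right_mono) (auto simp: power3_eq_cube)
      ultimately show ?case unfolding x_def y_def by (simp add: abs_mult)
    qed
  qed
qed

lemma C11_at_ln_real:
  fixes t :: real
  assumes "t > 0" shows "C11_at ln t"
proof -
  define m where "m = t / 2"
  have e: "\<forall>\<^sub>F x in nhds t. m < x"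
    using assms eventually_nhds_in_open[of "{m<..}" t] by (simp add: m_def)
  have m: "m > 0" using assms by (simp add: m_def)
  have "isCont (\<lambda>x. \<bar>ln x\<bar>) t" using assms by (intro continuous_intros) auto
  then have "((\<lambda>x. \<bar>ln x\<bar>) \<longlongrightarrow> \<bar>ln t\<bar>) (nhds t)" unfolding isCont_def by (rule tendsto_at_iff_tendsto_nhds[THEN iffD1])
  then have e2: "\<forall>\<^sub>F x in nhds t. \<bar>ln x\<bar> < \<bar>ln t\<bar> + 1"
    by (auto simp: order_tendsto_iff)
  show ?thesis
  proof (rule C11_atI[where g = "\<lambda>x. inverse x" and C = "\<bar>ln t\<bar> + 1" and D = "inverse m" and E = "inverse m ^ 2"])
    show "\<forall>\<^sub>F p in nhds (t, t). \<bar>ln (fst p)\<bar> \<le> \<bar>ln t\<bar> + 1"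
      using eventually_nhds_fst[OF e2] by eventually_elim auto
    show "\<forall>\<^sub>F p in nhds (t, t). norm (inverse (fst p)) \<le> inverse m"
      using eventually_nhds_fst[OF e]
      by eventually_elim (use m in \<open>auto simp: abs_inverse intro!: le_imp_inverse_le\<close>)
    show "\<forall>\<^sub>F p in nhds (t, t). \<bar>ln (snd p) - ln (fst p) - inverse (fst p) \<bullet> (snd p - fst p)\<bar>
      \<le> inverse m ^ 2 * (norm (snd p - fst p))\<^sup>2"
      using eventually_nhds_fst[OF e, of t] eventually_nhds_snd[OF e, of t]
    proof eventually_elim
      case (elim p)
      define x y where "x = fst p" and "y = snd p"
      have pos: "x > 0" "y > 0" using elim m by (auto simp: x_def y_def)
      have i: "inverse x \<le> inverse m" "inverse y \<le> inverse m"
        using elim m by (auto simp: x_def y_def intro!: le_imp_inverse_le)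
      \<comment> \<open>The inequality ln u \<le> u - 1 at y/x and at x/y traps the remainder
        between -(y - x)^2 / (x y) and 0, without a second derivative.\<close>
      have 1: "ln y - ln x \<le> y / x - 1" using pos ln_le_minus_one[of "y / x"] by (simp add: ln_div)
      have 2: "ln x - ln y \<le> x / y - 1" using pos ln_le_minus_one[of "x / y"] by (simp add: ln_div)
      have 3: "inverse x * (y - x) = y / x - 1" using pos by (simp add: field_simps)
      have 4: "x / y - 1 + (y / x - 1) = (inverse x * inverse y) * (y - x)\<^sup>2"
        using pos by (simp add: field_simps power2_eq_square)
      have "inverse x * inverse y \<le> inverse m * inverse m"
        using i m pos by (intro mult_mono) auto
      then have "(inverse x * inverse y) * (y - x)\<^sup>2 \<le> inverse m ^ 2 * (y - x)\<^sup>2"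
        by (intro mult_right_mono) (auto simp: power2_eq_square)
      then have "\<bar>ln y - ln x - inverse x * (y - x)\<bar> \<le> inverse m ^ 2 * (y - x)\<^sup>2"
        unfolding 3 using 1 2 4 by linarith
      then show ?case unfolding x_def y_def by simp
    qed
  qed
qed

lemma C11_at_divide:
  assumes "C11_at f a" "C11_at g a" "g a \<noteq> 0" shows "C11_at (\<lambda>x. f x / g x) a"
  unfolding divide_inverse
  by (intro C11_at_mult[OF assms(1)] C11_at_compose[OF assms(2)] C11_at_inverse_real[OF assms(3)])

lemma C11_at_minus: "C11_at f a \<Longrightarrow> C11_at (\<lambda>x. - f x) a"
  using C11_at_mult[OF C11_at_const[of "-1"], of f] by simp

lemma C11_at_diff: "C11_at f a \<Longrightarrow> C11_at g a \<Longrightarrow> C11_at (\<lambda>x. f x - g x) a"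
  using C11_at_add[of f a "\<lambda>x. - g x"] C11_at_minus[of g a] by simp

lemma C11_at_sum: "(\<And>i. i \<in> I \<Longrightarrow> C11_at (f i) a) \<Longrightarrow> C11_at (\<lambda>x. \<Sum>i\<in>I. f i x) a"
  by (induction I rule: infinite_finite_induct) (auto intro: C11_at_const C11_at_add)

lemma C11_at_prod: "(\<And>i. i \<in> I \<Longrightarrow> C11_at (f i) a) \<Longrightarrow> C11_at (\<lambda>x. \<Prod>i\<in>I. f i x) a"
  by (induction I rule: infinite_finite_induct) (auto intro: C11_at_const C11_at_mult)

text \<open>Both the Cramer quotients and the real part of the penalized objective agree with the
  function of interest only near a stabilizing gain, so a local congruence is required.\<close>

lemma C11_at_cong:
  assumes "\<forall>\<^sub>F x in nhds a. f x = g x" "C11_at g a" shows "C11_at f a"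
proof -
  obtain g' D where g: "\<forall>\<^sub>F p in nhds (a, a). \<bar>g (fst p)\<bar> \<le> D \<and> norm (g' (fst p)) \<le> D \<and>
     \<bar>g (snd p) - g (fst p) - g' (fst p) \<bullet> (snd p - fst p)\<bar> \<le> D * (norm (snd p - fst p))\<^sup>2"
    using assms unfolding C11_at_def by blast
  have "\<forall>\<^sub>F p in nhds (a, a). \<bar>f (fst p)\<bar> \<le> D \<and> norm (g' (fst p)) \<le> D \<and>
     \<bar>f (snd p) - f (fst p) - g' (fst p) \<bullet> (snd p - fst p)\<bar> \<le> D * (norm (snd p - fst p))\<^sup>2"
    using g eventually_nhds_fst[OF assms(1)] eventually_nhds_snd[OF assms(1)]
    by eventually_elim auto
  then show ?thesis unfolding C11_at_def by blast
qed

section \<open>Matrix-valued functions, entry by entry\<close>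

lemma C11_at_entry: "C11_at (\<lambda>K :: real ^ 'n ^ 'm. K $ i $ j) a"
  using C11_at_inner[of "axis i (axis j 1)" a] by (simp add: inner_axis')

lemma C11_at_matrix_mult:
  assumes "\<And>i j. C11_at (\<lambda>K. M K $ i $ j) a" "\<And>i j. C11_at (\<lambda>K. N K $ i $ j) a"
  shows "C11_at (\<lambda>K. (M K ** N K) $ i $ j) a"
  unfolding matrix_matrix_mult_def by (simp add: assms C11_at_sum C11_at_mult)

lemma C11_at_trace:
  assumes "\<And>i j. C11_at (\<lambda>K. M K $ i $ j) a"
  shows "C11_at (\<lambda>K. trace (M K)) a"
  unfolding trace_def by (intro C11_at_sum assms)

lemma C11_at_det:
  assumes "\<And>i j. C11_at (\<lambda>K. M K $ i $ j) a"
  shows "C11_at (\<lambda>K. det (M K)) a"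
  unfolding det_def by (intro C11_at_sum C11_at_mult C11_at_const C11_at_prod assms)

text \<open>A neighbourhood of \<open>(a, a)\<close> contains a product of two balls of a common
  radius, which decouples \<open>x\<close> from \<open>y\<close>. Dividing the quadratic remainder
  by the distance shows that \<open>g\<close> is the gradient throughout the ball, so the anonymous
  \<open>g\<close> of the definition can later be replaced by \<open>gradient f\<close>.\<close>

lemma C11_at_uniform:
  assumes "C11_at f a"
  obtains g C d where "d > 0" and
    "\<And>x y. \<lbrakk>dist a x < d; dist a y < d\<rbrakk> \<Longrightarrow> norm (g x) \<le> C \<and> \<bar>f y - f x - g x \<bullet> (y - x)\<bar> \<le> C * (norm (y - x))\<^sup>2"
    "\<And>x. dist a x < d \<Longrightarrow> GDERIV f x :> g x"
proof -
  obtain g C where g: "\<forall>\<^sub>F p in nhds (a, a). \<bar>f (fst p)\<bar> \<le> C \<and> norm (g (fst p)) \<le> C \<and>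
     \<bar>f (snd p) - f (fst p) - g (fst p) \<bullet> (snd p - fst p)\<bar> \<le> C * (norm (snd p - fst p))\<^sup>2"
    using assms unfolding C11_at_def by blast
  then obtain P Q where PQ: "eventually P (nhds a)" "eventually Q (nhds a)"
    "\<And>x y. P x \<Longrightarrow> Q y \<Longrightarrow> norm (g x) \<le> C \<and> \<bar>f y - f x - g x \<bullet> (y - x)\<bar> \<le> C * (norm (y - x))\<^sup>2"
    unfolding nhds_prod eventually_prod_filter by auto
  obtain d where d: "d > 0" "\<And>x. dist x a < d \<Longrightarrow> P x \<and> Q x"
    using eventually_conj[OF PQ(1,2)] unfolding eventually_nhds_metric by auto
  have 1: "norm (g x) \<le> C \<and> \<bar>f y - f x - g x \<bullet> (y - x)\<bar> \<le> C * (norm (y - x))\<^sup>2"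
    if "dist a x < d" "dist a y < d" for x y
    using PQ(3) d that by (metis dist_commute)
  have "GDERIV f x :> g x" if x: "dist a x < d" for x
    unfolding gderiv_def
  proof (rule has_derivativeI)
    show "bounded_linear (\<lambda>h. h \<bullet> g x)" by (rule bounded_linear_inner_left)
    have "\<forall>\<^sub>F y in at x. dist a y < d"
      using x by (intro eventually_at_in_open'[of "ball a d", simplified]) auto
    moreover have "\<forall>\<^sub>F y in at x. y \<noteq> x" by (rule eventually_neq_at_within)
    ultimately have "\<forall>\<^sub>F y in at x. norm ((f y - f x - (y - x) \<bullet> g x) /\<^sub>R norm (y - x)) \<le> C * norm (y - x)"
    proof eventually_elim
      case (elim y)
      then have "\<bar>f y - f x - (y - x) \<bullet> g x\<bar> \<le> C * norm (y - x) * norm (y - x)"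
        using 1[OF x, of y] by (simp add: inner_commute power2_eq_square mult.assoc)
      then show ?case using elim by (simp add: divide_simps)
    qed
    moreover have "((\<lambda>y. C * norm (y - x)) \<longlongrightarrow> C * norm (x - x)) (at x)"
      by (intro tendsto_intros filterlim_ident)
    then have "((\<lambda>y. C * norm (y - x)) \<longlongrightarrow> 0) (at x)" by simp
    ultimately show "((\<lambda>y. (f y - f x - (y - x) \<bullet> g x) /\<^sub>R norm (y - x)) \<longlongrightarrow> 0) (at x)"
      by (rule Lim_null_comparison)
  qed
  then show ?thesis using that[OF d(1), of g C] 1 by blast
qed

lemma gradient_eq:
  assumes "GDERIV f x :> D" shows "gradient f x = D"
  unfolding gradient_def
proof (rule the_equality)
  show "GDERIV f x :> D" by (rule assms)
next
  fix D' assume "GDERIV f x :> D'"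
  then have "(\<lambda>h. h \<bullet> D') = (\<lambda>h. h \<bullet> D)"
    using assms unfolding gderiv_def by (rule has_derivative_unique)
  then have "(D' - D) \<bullet> D' = (D' - D) \<bullet> D" by metis
  then have "(D' - D) \<bullet> (D' - D) = 0" by (simp add: inner_diff_right)
  then show "D' = D" by simp
qed

section \<open>Spectral radius and powers of a matrix\<close>

text \<open>Dependence is stated for the indexed family, because powers of a matrix may repeat and
  the set of values would hide the repetition. A repetition is itself a relation, with coefficients
  1 and -1.\<close>

lemma euclidean_sequence_dependent:
  fixes f :: "nat \<Rightarrow> 'a::euclidean_space"
  obtains c where "\<exists>i\<le>DIM('a). c i \<noteq> 0" "(\<Sum>i\<le>DIM('a). c i *\<^sub>R f i) = 0"
proof (cases "inj_on f {..DIM('a)}")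
  case True
  have "dependent (f ` {..DIM('a)})"
    by (rule dependent_biggerset) (auto simp: card_image[OF True])
  then obtain u where "\<exists>v\<in>f ` {..DIM('a)}. u v \<noteq> 0" "(\<Sum>v\<in>f ` {..DIM('a)}. u v *\<^sub>R v) = 0"
    by (subst (asm) dependent_finite) auto
  then show ?thesis
    by (intro that[of "u \<circ> f"]) (auto simp: sum.reindex[OF True])
next
  case False
  then obtain i j where ij: "i \<le> DIM('a)" "j \<le> DIM('a)" "i \<noteq> j" "f i = f j"
    unfolding inj_on_def by auto
  show ?thesis
  proof (rule that[of "\<lambda>k. if k = i then 1 else if k = j then -1 else 0"])
    have "(\<Sum>k\<le>DIM('a). (if k = i then 1 else if k = j then -1 else 0) *\<^sub>R f k) =
      (\<Sum>k\<le>DIM('a). (if k = i then f i else 0) - (if k = j then f j else 0))"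
      by (rule sum.cong) (use ij in auto)
    also have "\<dots> = 0" using ij by (simp add: sum_subtractf)
    finally show "(\<Sum>k\<le>DIM('a). (if k = i then 1 else if k = j then -1 else 0) *\<^sub>R f k) = 0" .
  qed (use ij in auto)
qed

text \<open>This is p(M) v, computed along the orbit of \<open>v\<close> so that the matrix p(M) is
  never formed.\<close>

definition poly_mv :: "complex poly \<Rightarrow> complex ^ 'n ^ 'n \<Rightarrow> complex ^ 'n \<Rightarrow> complex ^ 'n" where
  "poly_mv p M v = (\<Sum>i\<le>degree p. coeff p i *s ((*v) M ^^ i) v)"

lemma poly_mv_bound:
  assumes "degree p \<le> N"
  shows "poly_mv p M v = (\<Sum>i\<le>N. coeff p i *s ((*v) M ^^ i) v)"
  unfolding poly_mv_def
  by (rule sum.mono_neutral_left) (use assms in \<open>auto simp: coeff_eq_0\<close>)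

lemma matrix_vector_mult_smult:
  fixes M :: "'a::comm_ring_1 ^ 'n ^ 'm"
  shows "M *v (c *s v) = c *s (M *v v)"
  by (simp add: vec_eq_iff matrix_vector_mult_def sum_distrib_left mult.left_commute)

lemma funpow_mv_diff_smult:
  fixes M :: "'a::comm_ring_1 ^ 'n ^ 'n"
  shows "((*v) M ^^ i) (v - c *s w) = ((*v) M ^^ i) v - c *s ((*v) M ^^ i) w"
  by (induction i) (auto simp: matrix_vector_mult_diff_distrib matrix_vector_mult_smult)

text \<open>Moves a linear factor from the polynomial to the vector, so that inductions on the
  degree replace \<open>v\<close> by (M - l) v. The coefficients of (X - l) q are those of q shifted
  by one, minus \<open>l\<close> times those of q.\<close>

lemma poly_mv_linear_factor:
  "poly_mv ([:- l, 1:] * q) M v = poly_mv q M (M *v v - l *s v)"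
proof -
  let ?N = "degree q"
  have "degree ([:- l, 1:] * q) \<le> Suc ?N"
    by (rule order.trans[OF degree_mult_le]) simp
  then have "poly_mv ([:- l, 1:] * q) M v =
      (\<Sum>i\<le>Suc ?N. coeff ([:- l, 1:] * q) i *s ((*v) M ^^ i) v)"
    by (rule poly_mv_bound)
  also have "\<dots> = (\<Sum>i\<le>Suc ?N. coeff (pCons 0 q) i *s ((*v) M ^^ i) v)
      - (\<Sum>i\<le>Suc ?N. (l * coeff q i) *s ((*v) M ^^ i) v)"
  proof -
    have "coeff ([:- l, 1:] * q) i = coeff (pCons 0 q) i - l * coeff q i" for i by simp
    then show ?thesis by (simp only: vector_sub_rdistrib sum_subtractf)
  qed
  also have "(\<Sum>i\<le>Suc ?N. coeff (pCons 0 q) i *s ((*v) M ^^ i) v) =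
      (\<Sum>i\<le>?N. coeff q i *s ((*v) M ^^ i) (M *v v))"
    by (subst sum.atMost_Suc_shift) (simp add: funpow_swap1)
  also have "(\<Sum>i\<le>Suc ?N. (l * coeff q i) *s ((*v) M ^^ i) v) =
      (\<Sum>i\<le>?N. (l * coeff q i) *s ((*v) M ^^ i) v)"
    by (simp add: coeff_eq_0)
  also have "(\<Sum>i\<le>?N. coeff q i *s ((*v) M ^^ i) (M *v v)) - \<dots> = poly_mv q M (M *v v - l *s v)"
    unfolding poly_mv_def
    by (simp only: funpow_mv_diff_smult sum_subtractf vector_ssub_ldistrib vector_smult_assoc mult.commute[of l])
  finally show ?thesis .
qed

lemma poly_mv_eigenvector:
  assumes "M *v v = l *s v"
  shows "poly_mv p M v = poly p l *s v"
proof -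
  have pow: "((*v) M ^^ i) v = l ^ i *s v" for i
    by (induction i) (auto simp: matrix_vector_mult_smult assms vector_smult_assoc mult.commute)
  have "poly_mv p M v = (\<Sum>i\<le>degree p. (coeff p i * l ^ i) *s v)"
    unfolding poly_mv_def pow vector_smult_assoc ..
  also have "\<dots> = (\<Sum>i\<le>degree p. coeff p i * l ^ i) *s v"
    by (simp add: vec_eq_iff sum_distrib_right)
  finally show ?thesis by (simp add: poly_altdef)
qed

lemma matrix_vector_mult_sum_left:
  fixes f :: "'b \<Rightarrow> 'a::semiring_1 ^ 'n ^ 'm"
  shows "(\<Sum>i\<in>I. f i) *v v = (\<Sum>i\<in>I. f i *v v)"
  by (induction I rule: infinite_finite_induct) (auto simp: matrix_vector_mult_add_rdistrib)

text \<open>The powers of M up to the real dimension of the matrix space satisfy a linear relation.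
  Any nonzero annihilating polynomial serves the later inductions, so the sharper Cayley-Hamilton
  theorem is not invoked.\<close>

lemma annihilating_polynomial:
  fixes M :: "complex ^ 'n ^ 'n"
  obtains p where "p \<noteq> 0" "\<And>v. poly_mv p M v = 0"
proof -
  define pw where "pw i = ((**) M ^^ i) (mat 1)" for i
  have pw: "pw i *v v = ((*v) M ^^ i) v" for i v
    unfolding pw_def by (induction i) (auto simp: matrix_vector_mul_assoc[symmetric])
  let ?D = "DIM(complex ^ 'n ^ 'n)"
  obtain c where c: "\<exists>i\<le>?D. c i \<noteq> 0" "(\<Sum>i\<le>?D. c i *\<^sub>R pw i) = 0"
    by (rule euclidean_sequence_dependent)
  define p where "p = (\<Sum>i\<le>?D. monom (complex_of_real (c i)) i)"
  have coeff: "coeff p i = (if i \<le> ?D then complex_of_real (c i) else 0)" for i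
    unfolding p_def by (simp add: coeff_sum)
  have "p \<noteq> 0" using c(1) coeff by (metis coeff_0 of_real_eq_0_iff)
  moreover have "poly_mv p M v = 0" for v
  proof -
    have "degree p \<le> ?D" by (rule degree_le) (simp add: coeff)
    then have "poly_mv p M v = (\<Sum>i\<le>?D. complex_of_real (c i) *s (pw i *v v))"
      unfolding pw by (simp add: poly_mv_bound coeff)
    also have "\<dots> = (\<Sum>i\<le>?D. (c i *\<^sub>R pw i) *v v)"
      by (rule sum.cong) (auto simp: vec_eq_iff matrix_vector_mult_def sum_distrib_left of_real_def)
    also have "\<dots> = (\<Sum>i\<le>?D. c i *\<^sub>R pw i) *v v"
      by (rule matrix_vector_mult_sum_left[symmetric])
    finally show ?thesis using c(2) by simp
  qed
  ultimately show ?thesis using that by blast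
qed

lemma complex_poly_linear_factor:
  fixes p :: "complex poly"
  assumes "degree p > 0"
  obtains l q where "p = [:- l, 1:] * q" "degree q < degree p"
proof -
  obtain l where "poly p l = 0"
    using assms fundamental_theorem_of_algebra[of p] by (auto simp: constant_degree)
  then obtain q where q: "p = [:- l, 1:] * q" by (auto simp: poly_eq_0_iff_dvd)
  moreover have "q \<noteq> 0" using assms q by auto
  then have "degree q < degree p" unfolding q by (subst degree_mult_eq) auto
  ultimately show ?thesis using that by blast
qed

text \<open>Apply the linear factors of p to \<open>v\<close> one after the other: the last vector
  before 0 is reached is an eigenvector. A nonzero constant polynomial cannot annihilate a nonzero
  vector.\<close>

lemma poly_mv_annihilated_eigenvector:
  assumes "p \<noteq> 0" "poly_mv p M v = 0" "v \<noteq> 0"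
  shows "\<exists>l w. w \<noteq> 0 \<and> M *v w = l *s w"
  using assms
proof (induction "degree p" arbitrary: p v rule: less_induct)
  case less
  show ?case
  proof (cases "degree p = 0")
    case True
    then have "coeff p 0 \<noteq> 0" using less.prems(1) by (metis leading_coeff_0_iff)
    then show ?thesis using less.prems True by (auto simp: poly_mv_def vec_eq_iff)
  next
    case False
    then obtain l q where q: "p = [:- l, 1:] * q" "degree q < degree p"
      using complex_poly_linear_factor by blast
    show ?thesis
    proof (cases "M *v v - l *s v = 0")
      case True
      then show ?thesis using less.prems(3) by auto
    next
      case False
      have "poly_mv q M (M *v v - l *s v) = 0"
        using less.prems(2) unfolding q(1) poly_mv_linear_factor .
      moreover have "q \<noteq> 0" using q(1) less.prems(1) by auto
      ultimately show ?thesis using less.hyps[OF q(2)] False by blast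
    qed
  qed
qed

text \<open>Every eigenvalue is a root of the annihilating polynomial. Finiteness and nonemptiness
  together give the \<open>Max\<close> in \<open>spectral_radius\<close> its intended
  meaning.\<close>

lemma eigenvalues_finite: "finite (eigenvalues M)"
proof -
  obtain p where p: "p \<noteq> 0" "\<And>v. poly_mv p (map_matrix complex_of_real M) v = 0"
    using annihilating_polynomial by blast
  have "eigenvalues M \<subseteq> {l. poly p l = 0}"
  proof
    fix l assume "l \<in> eigenvalues M"
    then obtain v where v: "v \<noteq> 0" "map_matrix complex_of_real M *v v = l *s v"
      unfolding eigenvalues_def by blast
    have "poly p l *s v = 0" using poly_mv_eigenvector[OF v(2), of p] p(2) by simp
    then show "l \<in> {l. poly p l = 0}" using v(1) by (auto simp: vec_eq_iff)
  qed
  then show ?thesis using poly_roots_finite[OF p(1)] finite_subset by blast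
qed

lemma eigenvalues_nonempty: "eigenvalues M \<noteq> {}"
proof -
  obtain p where p: "p \<noteq> 0" "\<And>v. poly_mv p (map_matrix complex_of_real M) v = 0"
    using annihilating_polynomial by blast
  have "(1 :: complex ^ 'n) \<noteq> 0" by (simp add: vec_eq_iff)
  from poly_mv_annihilated_eigenvector[OF p(1) p(2) this]
  show ?thesis unfolding eigenvalues_def by blast
qed

lemma spectral_radius_less_iff: "spectral_radius M < r \<longleftrightarrow> (\<forall>l\<in>eigenvalues M. cmod l < r)"
  unfolding spectral_radius_def
  by (subst Max_less_iff) (auto simp: eigenvalues_finite eigenvalues_nonempty)

section \<open>Decay of orbits and Lyapunov certificates\<close>

lemma perturbed_contraction_tendsto_0:
  fixes a b :: "nat \<Rightarrow> 'a::real_normed_vector"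
  assumes step: "\<And>k. norm (a (Suc k)) \<le> r * norm (a k) + norm (b k)"
    and r: "0 \<le> r" "r < 1" and b: "b \<longlonglongrightarrow> 0"
  shows "a \<longlonglongrightarrow> 0"
proof (rule LIMSEQ_I)
  fix e :: real assume e: "e > 0"
  \<comment> \<open>Chosen so that e/2 is the fixed point of t \<mapsto> r t + d; the recursion then
    decays geometrically down to that level.\<close>
  define d where "d = e * (1 - r) / 2"
  have d: "d > 0" using e r by (simp add: d_def)
  obtain N where N: "\<And>k. k \<ge> N \<Longrightarrow> norm (b k) < d"
    using LIMSEQ_D[OF b d] by auto
  have bnd: "norm (a (N + k)) \<le> r ^ k * norm (a N) + e / 2" for k
  proof (induction k)
    case 0
    then show ?case using e by simp
  next
    case (Suc k)
    have "norm (a (N + Suc k)) \<le> r * norm (a (N + k)) + d"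
      using step[of "N + k"] N[of "N + k"] by simp
    also have "\<dots> \<le> r * (r ^ k * norm (a N) + e / 2) + d"
      using Suc r by (intro add_mono mult_left_mono) auto
    also have "\<dots> = r ^ Suc k * norm (a N) + e / 2" by (simp add: d_def field_simps)
    finally show ?case .
  qed
  have "(\<lambda>k. r ^ k * norm (a N)) \<longlonglongrightarrow> 0 * norm (a N)"
    using r by (intro tendsto_mult LIMSEQ_power_zero tendsto_const) auto
  then have "(\<lambda>k. r ^ k * norm (a N)) \<longlonglongrightarrow> 0" by simp
  from LIMSEQ_D[OF this, of "e / 2"] e
  obtain L where L: "\<And>k. k \<ge> L \<Longrightarrow> norm (r ^ k * norm (a N)) < e / 2" by auto
  have "norm (a n - 0) < e" if "n \<ge> N + L" for n
  proof -
    have "n - N \<ge> L" "N + (n - N) = n" using that by auto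
    then show ?thesis using L[of "n - N"] bnd[of "n - N"] by auto
  qed
  then show "\<exists>no. \<forall>n\<ge>no. norm (a n - 0) < e" by blast
qed

lemma norm_smult_complex: "norm (c *s v) = cmod c * norm (v :: complex ^ 'n)"
  by (simp add: norm_vec_def L2_set_def norm_mult power_mult_distrib sum_distrib_left[symmetric] real_sqrt_mult)

text \<open>Peel off one root \<open>l\<close> of the annihilating polynomial at a time: if \<open>l\<close> is an eigenvalue, then
  \<open>M\<^sup>k\<^sup>+\<^sup>1 v = l M\<^sup>k v + M\<^sup>k w\<close> with \<open>w = (M - l) v\<close> and \<open>\<bar>l\<bar> < 1\<close>; otherwise \<open>M - l\<close> is
  injective and the factor can be dropped.\<close>

lemma power_tendsto_0_of_eigenvalues:
  fixes M :: "complex ^ 'n ^ 'n"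
  assumes ev: "\<And>l w. w \<noteq> 0 \<Longrightarrow> M *v w = l *s w \<Longrightarrow> cmod l < 1"
    and "p \<noteq> 0" "poly_mv p M v = 0"
  shows "(\<lambda>k. ((*v) M ^^ k) v) \<longlonglongrightarrow> 0"
  using assms(2,3)
proof (induction "degree p" arbitrary: p v rule: less_induct)
  case less
  show ?case
  proof (cases "degree p = 0")
    case True
    then have "coeff p 0 \<noteq> 0" using less.prems(1) by (metis leading_coeff_0_iff)
    then have "v = 0" using less.prems True by (auto simp: poly_mv_def vec_eq_iff)
    moreover have "((*v) M ^^ k) 0 = 0" for k by (induction k) auto
    ultimately show ?thesis by simp
  next
    case False
    then obtain l q where q: "p = [:- l, 1:] * q" "degree q < degree p"
      using complex_poly_linear_factor by blast
    have "q \<noteq> 0" using q(1) less.prems(1) by auto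
    define w where "w = M *v v - l *s v"
    have "poly_mv q M w = 0"
      using less.prems(2) unfolding q(1) poly_mv_linear_factor w_def .
    then have w0: "(\<lambda>k. ((*v) M ^^ k) w) \<longlonglongrightarrow> 0" using less.hyps q(2) \<open>q \<noteq> 0\<close> by blast
    have step: "((*v) M ^^ Suc k) v = l *s ((*v) M ^^ k) v + ((*v) M ^^ k) w" for k
      unfolding w_def funpow_mv_diff_smult by (simp add: funpow_swap1)
    show ?thesis
    \<comment> \<open>The split is on the size of \<open>l\<close>, not on whether \<open>l\<close>
      is an eigenvalue: a root of modulus below 1 yields a contraction in either case, and a root of
      modulus at least 1 is no eigenvalue by \<open>ev\<close>.\<close>
    proof (cases "cmod l < 1")
      case True
      show ?thesis
      proof (rule perturbed_contraction_tendsto_0[OF _ _ True w0])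
        show "norm (((*v) M ^^ Suc k) v) \<le> cmod l * norm (((*v) M ^^ k) v) + norm (((*v) M ^^ k) w)" for k
          unfolding step by (rule order.trans[OF norm_triangle_ineq]) (simp add: norm_smult_complex)
      qed simp
    next
      case notev: False
      have "poly_mv q M v = 0"
      proof (rule ccontr)
        assume nz: "poly_mv q M v \<noteq> 0"
        \<comment> \<open>Since polynomials in M commute, (M - l) q(M) v = q(M) w = 0, so a nonzero
          q(M) v would be a forbidden eigenvector.\<close>
        have "M *v poly_mv q M v = l *s poly_mv q M v"
        proof -
          have "poly_mv q M w = M *v poly_mv q M v - l *s poly_mv q M v"
          proof -
            have "M *v ((*v) M ^^ i) u = ((*v) M ^^ i) (M *v u)" for i u
              by (simp add: funpow_swap1)
            moreover have "M *v (\<Sum>i\<in>I. f i) = (\<Sum>i\<in>I. M *v f i)" for I :: "nat set" and f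
              by (induction I rule: infinite_finite_induct) (auto simp: matrix_vector_right_distrib)
            moreover have "l *s (\<Sum>i\<in>I. f i) = (\<Sum>i\<in>I. l *s f i)" for I :: "nat set" and f :: "nat \<Rightarrow> complex ^ 'n"
              by (simp add: vec_eq_iff sum_distrib_left)
            ultimately show ?thesis
              unfolding poly_mv_def w_def funpow_mv_diff_smult
              by (simp add: matrix_vector_mult_smult vector_ssub_ldistrib sum_subtractf vector_smult_assoc mult.commute)
          qed
          then show ?thesis using \<open>poly_mv q M w = 0\<close> by simp
        qed
        then show False using ev[OF nz] notev by blast
      qed
      then show ?thesis using less.hyps q(2) \<open>q \<noteq> 0\<close> by blast
    qed
  qed
qed

text \<open>The form in which stability is used for the Stein equations: pointwise decay of orbits,
  with no operator norm and no rate.\<close>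

definition power_null :: "real ^ 'n ^ 'n \<Rightarrow> bool" where
  "power_null F \<longleftrightarrow> (\<forall>v. (\<lambda>k. ((*v) F ^^ k) v) \<longlonglongrightarrow> 0)"

text \<open>The entrywise embedding \<open>c\<close> intertwines F with its complexification, so
  real orbits inherit the decay of complex ones.\<close>

lemma power_null_of_spectral_radius:
  fixes F :: "real ^ 'n ^ 'n"
  assumes "spectral_radius F < 1"
  shows "power_null F"
  unfolding power_null_def
proof
  fix v :: "real ^ 'n"
  define M where "M = map_matrix complex_of_real F"
  define c where "c v = (\<chi> i. complex_of_real (v $ i))" for v :: "real ^ 'n"
  have Mc: "M *v c u = c (F *v u)" for u
    unfolding M_def c_def map_matrix_def by (simp add: vec_eq_iff matrix_vector_mult_def)
  have powc: "((*v) M ^^ k) (c v) = c (((*v) F ^^ k) v)" for k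
    by (induction k) (simp_all add: Mc)
  obtain p where p: "p \<noteq> 0" "\<And>v. poly_mv p M v = 0"
    using annihilating_polynomial by blast
  have ev: "cmod l < 1" if "w \<noteq> 0" "M *v w = l *s w" for l w
    using assms that unfolding spectral_radius_less_iff eigenvalues_def M_def by blast
  have "(\<lambda>k. ((*v) M ^^ k) (c v)) \<longlonglongrightarrow> 0"
    by (rule power_tendsto_0_of_eigenvalues[OF ev p])
  then have "(\<lambda>k. c (((*v) F ^^ k) v)) \<longlonglongrightarrow> 0" unfolding powc .
  then have "(\<lambda>k. c (((*v) F ^^ k) v) $ i) \<longlonglongrightarrow> 0 $ i" for i by (rule tendsto_vec_nth)
  then have "(\<lambda>k. complex_of_real ((((*v) F ^^ k) v) $ i)) \<longlonglongrightarrow> complex_of_real 0" for i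
    unfolding c_def by simp
  then have "(\<lambda>k. (((*v) F ^^ k) v) $ i) \<longlonglongrightarrow> 0" for i
    unfolding tendsto_of_real_iff .
  then show "(\<lambda>k. ((*v) F ^^ k) v) \<longlonglongrightarrow> 0"
    by (intro vec_tendstoI) simp
qed

lemma inner_funpow_transpose:
  fixes F :: "real ^ 'n ^ 'n"
  shows "u \<bullet> ((*v) (transpose F) ^^ k) v = ((*v) F ^^ k) u \<bullet> v"
proof (induction k arbitrary: v)
  case (Suc k)
  have "u \<bullet> ((*v) (transpose F) ^^ Suc k) v = u \<bullet> ((*v) (transpose F) ^^ k) (transpose F *v v)"
    by (simp add: funpow_swap1)
  also have "\<dots> = ((*v) F ^^ Suc k) u \<bullet> v"
    unfolding Suc by (simp add: dot_lmul_matrix inner_commute)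
  finally show ?case .
qed simp

text \<open>Entry \<open>i\<close> of the transposed orbit of \<open>v\<close> is the inner product
  of \<open>v\<close> with the orbit of the i-th unit vector under F. The equation for Z, where the
  closed loop stands on the left, needs this.\<close>

lemma power_null_transpose:
  assumes "power_null F" shows "power_null (transpose F)"
  unfolding power_null_def
proof
  fix v
  show "(\<lambda>k. ((*v) (transpose F) ^^ k) v) \<longlonglongrightarrow> 0"
  proof (rule vec_tendstoI)
    fix i
    have "(\<lambda>k. ((*v) F ^^ k) (axis i 1) \<bullet> v) \<longlonglongrightarrow> 0 \<bullet> v"
      using assms unfolding power_null_def by (intro tendsto_inner tendsto_const) auto
    then show "(\<lambda>k. ((*v) (transpose F) ^^ k) v $ i) \<longlonglongrightarrow> 0 $ i"
      unfolding inner_funpow_transpose[symmetric] by (simp add: inner_axis')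
  qed
qed

text \<open>The real and imaginary parts \<open>a, b\<close> of an eigenvector for \<open>l\<close> satisfy
  \<open>Fa \<bullet> P(Fa) + Fb \<bullet> P(Fb) = \<bar>l\<bar>\<^sup>2 (a \<bullet> Pa + b \<bullet> Pb)\<close>.\<close>

lemma spectral_radius_less_1_of_lyapunov:
  fixes F P :: "real ^ 'n ^ 'n"
  assumes nonneg: "\<And>v. v \<bullet> (P *v v) \<ge> 0"
    and dec: "\<And>v. v \<noteq> 0 \<Longrightarrow> (F *v v) \<bullet> (P *v (F *v v)) < v \<bullet> (P *v v)"
  shows "spectral_radius F < 1"
  unfolding spectral_radius_less_iff
proof
  fix l assume "l \<in> eigenvalues F"
  then obtain w where w: "w \<noteq> 0" "map_matrix complex_of_real F *v w = l *s w"
    unfolding eigenvalues_def by blast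
  define a b where "a = (\<chi> i. Re (w $ i))" and "b = (\<chi> i. Im (w $ i))"
  have comp: "(\<Sum>j\<in>UNIV. complex_of_real (F $ i $ j) * w $ j) = l * w $ i" for i
    using w(2) unfolding vec_eq_iff matrix_vector_mult_def map_matrix_def by simp
  have Fa: "F *v a = Re l *\<^sub>R a - Im l *\<^sub>R b"
  proof -
    have "(F *v a) $ i = Re l * a $ i - Im l * b $ i" for i
      using arg_cong[OF comp[of i], of Re] by (simp add: matrix_vector_mult_def a_def b_def)
    then show ?thesis by (simp add: vec_eq_iff)
  qed
  have Fb: "F *v b = Im l *\<^sub>R a + Re l *\<^sub>R b"
  proof -
    have "(F *v b) $ i = Im l * a $ i + Re l * b $ i" for i
      using arg_cong[OF comp[of i], of Im] by (simp add: matrix_vector_mult_def a_def b_def)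
    then show ?thesis by (simp add: vec_eq_iff)
  qed
  let ?f = "\<lambda>v. v \<bullet> (P *v v)"
  \<comment> \<open>The mixed terms a \<bullet> Pb and b \<bullet> Pa cancel in the sum, leaving a
    multiple of the form itself.\<close>
  have eq: "?f (F *v a) + ?f (F *v b) = (cmod l)\<^sup>2 * (?f a + ?f b)"
    unfolding Fa Fb cmod_power2
    by (simp add: matrix_vector_mult_diff_distrib matrix_vector_right_distrib matrix_vector_mult_scaleR
        inner_diff_left inner_diff_right inner_add_left inner_add_right algebra_simps power2_eq_square)
  have "a \<noteq> 0 \<or> b \<noteq> 0"
    using w(1) by (auto simp: a_def b_def vec_eq_iff complex_eq_iff)
  moreover have le: "?f (F *v v) \<le> ?f v" for v
    by (cases "v = 0") (auto dest: dec)
  ultimately have "?f (F *v a) + ?f (F *v b) < ?f a + ?f b"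
    using dec[of a] dec[of b] le[of a] le[of b] by (auto intro: add_less_le_mono add_le_less_mono)
  then have "(cmod l)\<^sup>2 * (?f a + ?f b) < 1 * (?f a + ?f b)" unfolding eq by simp
  moreover have "?f a + ?f b \<ge> 0" using nonneg by simp
  ultimately have "(cmod l)\<^sup>2 < 1" by (rule mult_right_less_imp_less)
  then show "cmod l < 1" by (simp add: abs_square_less_1)
qed

section \<open>Stein equations, determinants and traces\<close>

text \<open>One operator for all three equations, with F the closed loop or its transpose: s =
  \<gamma> for P, s = \<gamma>^2 with the transpose for Z, and s = 1 for the Lyapunov
  equation.\<close>

definition stein :: "real \<Rightarrow> real ^ 'n ^ 'n \<Rightarrow> real ^ 'n ^ 'n \<Rightarrow> real ^ 'n ^ 'n" where
  "stein s F X = X - s *\<^sub>R (transpose F ** X ** F)"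

lemma inner_congruence:
  fixes F :: "real ^ 'n ^ 'm" and X :: "real ^ 'm ^ 'm"
  shows "u \<bullet> ((transpose F ** X ** F) *v v) = (F *v u) \<bullet> (X *v (F *v v))"
proof -
  have "(transpose F ** X ** F) *v v = transpose F *v (X *v (F *v v))"
    by (simp only: matrix_vector_mul_assoc matrix_mul_assoc)
  then show ?thesis by (metis dot_lmul_matrix inner_commute transpose_matrix_vector)
qed

lemma inner_stein:
  "u \<bullet> (stein s F X *v v) = u \<bullet> (X *v v) - s * ((F *v u) \<bullet> (X *v (F *v v)))"
  by (simp add: stein_def matrix_vector_mult_diff_rdistrib scaleR_matrix_vector_assoc[symmetric]
      inner_diff_right inner_congruence)

lemma matrix_eq_0_if_inner:
  fixes X :: "real ^ 'n ^ 'm"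
  assumes "\<And>u v. u \<bullet> (X *v v) = 0" shows "X = 0"
proof -
  have "X *v v = 0 *v v" for v using assms[of "X *v v" v] by simp
  then show ?thesis using matrix_eq[of X 0] by blast
qed

text \<open>The decay comes from the orbits of F; the factor s^k is merely bounded by 1, which is
  why the undiscounted case s = 1 is covered.\<close>

lemma power_null_form_tendsto_0:
  fixes F X :: "real ^ 'n ^ 'n"
  assumes "power_null F" "0 \<le> s" "s \<le> 1"
  shows "(\<lambda>k. s ^ k * (((*v) F ^^ k) u \<bullet> (X *v (((*v) F ^^ k) v)))) \<longlonglongrightarrow> 0"
proof -
  have "(\<lambda>k. ((*v) F ^^ k) u \<bullet> (X *v (((*v) F ^^ k) v))) \<longlonglongrightarrow> 0 \<bullet> (X *v 0)"
    using assms(1) unfolding power_null_def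
    by (intro tendsto_inner bounded_linear.tendsto[OF matrix_vector_mul_bounded_linear]) auto
  then have lim: "(\<lambda>k. ((*v) F ^^ k) u \<bullet> (X *v (((*v) F ^^ k) v))) \<longlonglongrightarrow> 0" by simp
  have "norm (s ^ k * a) \<le> norm a" for k and a :: real
    using assms(2,3) power_le_one[of s k]
    by (simp add: abs_mult mult_left_le_one_le)
  then show ?thesis
    by (intro Lim_null_comparison[OF _ tendsto_norm_zero[OF lim]] always_eventually allI)
qed

text \<open>Unrolling X = s F^T X F along the orbits expresses the constant u \<bullet> Xv as a
  sequence tending to 0.\<close>

lemma stein_injective:
  assumes "power_null F" "0 \<le> s" "s \<le> 1" "stein s F X = 0"
  shows "X = 0"
proof (rule matrix_eq_0_if_inner)
  fix u v
  have step: "u \<bullet> (X *v v) = s * ((F *v u) \<bullet> (X *v (F *v v)))" for u v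
    using inner_stein[of u s F X v] assms(4) by simp
  have "u \<bullet> (X *v v) = s ^ k * (((*v) F ^^ k) u \<bullet> (X *v (((*v) F ^^ k) v)))" for k
    by (induction k) (simp_all, metis step mult.assoc mult.commute)
  then have "(\<lambda>k. u \<bullet> (X *v v)) \<longlonglongrightarrow> 0"
    using power_null_form_tendsto_0[OF assms(1-3), of u X v] by presburger
  then show "u \<bullet> (X *v v) = 0" by (simp add: LIMSEQ_const_iff)
qed

lemma transpose_add: "transpose (X + Y) = transpose X + transpose (Y :: 'a::semiring_1 ^ 'n ^ 'm)"
  by (simp add: vec_eq_iff transpose_def)

lemma transpose_diff: "transpose (X - Y) = transpose X - transpose (Y :: real ^ 'n ^ 'm)"
  by (simp add: vec_eq_iff transpose_def)

lemma transpose_scaleR: "transpose (c *\<^sub>R X) = c *\<^sub>R transpose (X :: real ^ 'n ^ 'm)"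
  by (simp add: vec_eq_iff transpose_def)

lemma linear_stein: "linear (stein s F)"
  unfolding stein_def
  by (intro linearI) (simp_all add: vec_eq_iff matrix_matrix_mult_def transpose_def
      sum_distrib_left sum_distrib_right sum.distrib algebra_simps)

text \<open>In finite dimension injectivity already gives surjectivity, so no series representation
  of the solution has to be summed.\<close>

lemma stein_ex1:
  assumes "power_null F" "0 \<le> s" "s \<le> 1"
  shows "\<exists>!X. stein s F X = C"
proof -
  have "inj (stein s F)"
    unfolding linear_injective_0[OF linear_stein] using stein_injective[OF assms] by blast
  moreover from this have "surj (stein s F)"
    by (rule linear_injective_imp_surjective[OF linear_stein]) simp
  ultimately show ?thesis by (metis injD surjD)
qed

lemma stein_transpose: "transpose (stein s F X) = stein s F (transpose X)"
  by (simp add: stein_def transpose_diff transpose_scaleR matrix_transpose_mul matrix_mul_assoc)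

lemma stein_symmetric:
  assumes "power_null F" "0 \<le> s" "s \<le> 1" "stein s F X = C" "transpose C = C"
  shows "transpose X = X"
  using stein_ex1[OF assms(1-3), of C] assms(4,5) stein_transpose[of s F X] by metis

text \<open>Along an orbit the discounted form of X decreases, by the nonnegative form of C at each
  step, and tends to 0; hence its initial value is nonnegative. Then X = C + s F^T X F dominates
  C.\<close>

lemma stein_psd:
  assumes "power_null F" "0 \<le> s" "s \<le> 1" "stein s F X = C"
    and psd: "\<And>v. v \<bullet> (C *v v) \<ge> 0"
  shows "v \<bullet> (X *v v) \<ge> v \<bullet> (C *v v)"
proof -
  have nonneg: "w \<bullet> (X *v w) \<ge> 0" for w
  proof -
    define f where "f k = s ^ k * (((*v) F ^^ k) w \<bullet> (X *v (((*v) F ^^ k) w)))" for k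
    have "f k - f (Suc k) = s ^ k * (((*v) F ^^ k) w \<bullet> (C *v (((*v) F ^^ k) w)))" for k
      unfolding f_def assms(4)[symmetric] inner_stein by (simp add: algebra_simps)
    then have "f (Suc k) \<le> f k" for k
      using psd assms(2) by (metis diff_ge_0_iff_ge mult_nonneg_nonneg zero_le_power)
    then have "decseq f" by (rule decseq_SucI)
    moreover have "f \<longlonglongrightarrow> 0" unfolding f_def by (rule power_null_form_tendsto_0[OF assms(1-3)])
    ultimately have "f 0 \<ge> 0" by (rule decseq_ge)
    then show ?thesis by (simp add: f_def)
  qed
  show ?thesis
    using inner_stein[of v s F X v] assms(2,4) mult_nonneg_nonneg[OF assms(2) nonneg[of "F *v v"]]
    by simp
qed

text \<open>The Stein equation is a linear system for the entries of \<open>X\<close>, indexed by pairs; Cramer's rule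
  expresses its solution through determinants of the data.\<close>

lemma C11_at_stein_solution:
  fixes F X C :: "'a::real_inner \<Rightarrow> real ^ 'n ^ 'n"
  assumes s: "0 \<le> s" "s \<le> 1"
    and ev: "\<forall>\<^sub>F K in nhds a. power_null (F K) \<and> stein s (F K) (X K) = C K"
    and F: "\<And>i j. C11_at (\<lambda>K. F K $ i $ j) a" and C: "\<And>i j. C11_at (\<lambda>K. C K $ i $ j) a"
  shows "C11_at (\<lambda>K. X K $ i $ j) a"
proof -
  \<comment> \<open>The matrix of the Stein operator on pairs of indices, that is, the identity
    minus \<open>s\<close> times the Kronecker square of the transpose of F.\<close>
  define M where "M K = (\<chi> p q. (if p = q then 1 else 0) - s * (F K $ fst q $ fst p * F K $ snd q $ snd p)
     :: real ^ ('n \<times> 'n) ^ ('n \<times> 'n))" for K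
  define vc where "vc Y = (\<chi> p. Y $ fst p $ snd p)" for Y :: "real ^ 'n ^ 'n"
  have M_vc: "M K *v vc Y = vc (stein s (F K) Y)" for K Y
  proof -
    have "(M K *v vc Y) $ (i, j) = stein s (F K) Y $ i $ j" for i j
    proof -
      have "(M K *v vc Y) $ (i, j) = (\<Sum>q\<in>UNIV. (if (i, j) = q then vc Y $ q else 0)
          - s * (F K $ fst q $ i * F K $ snd q $ j * Y $ fst q $ snd q))"
        unfolding matrix_vector_mult_def M_def
        by (simp, rule sum.cong) (auto simp: vc_def algebra_simps)
      also have "\<dots> = Y $ i $ j - s * (\<Sum>q\<in>UNIV. F K $ fst q $ i * F K $ snd q $ j * Y $ fst q $ snd q)"
        by (simp add: sum_subtractf sum_distrib_left vc_def)
      also have "(\<Sum>q\<in>UNIV. F K $ fst q $ i * F K $ snd q $ j * Y $ fst q $ snd q) =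
          (\<Sum>k\<in>UNIV. \<Sum>l\<in>UNIV. F K $ k $ i * F K $ l $ j * Y $ k $ l)"
        unfolding UNIV_Times_UNIV[symmetric] by (simp add: sum.cartesian_product case_prod_beta)
      also have "\<dots> = (transpose (F K) ** Y ** F K) $ i $ j"
        unfolding matrix_matrix_mult_def transpose_def
        by (simp add: sum_distrib_left sum_distrib_right mult.assoc mult.commute mult.left_commute)
          (subst sum.swap, simp add: mult.commute)
      finally show ?thesis by (simp add: stein_def)
    qed
    then show ?thesis by (simp add: vec_eq_iff vc_def)
  qed
  have det: "det (M K) \<noteq> 0" if "power_null (F K)" for K
  proof -
    have "x = 0" if "M K *v x = 0" for x
    proof -
      define Y where "Y = (\<chi> i j. x $ (i, j))"
      have x: "x = vc Y" by (simp add: vec_eq_iff vc_def Y_def)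
      have "vc (stein s (F K) Y) = 0" using that unfolding x M_vc .
      then have "stein s (F K) Y = 0" by (simp add: vec_eq_iff vc_def)
      then have "Y = 0" using stein_injective[OF \<open>power_null (F K)\<close> s] by blast
      then show ?thesis unfolding x by (simp add: vec_eq_iff vc_def)
    qed
    then show ?thesis
      unfolding invertible_det_nz[symmetric] invertible_left_inverse matrix_left_invertible_ker by blast
  qed
  \<comment> \<open>Cramer's numerator for the unknown indexed by \<open>(i, j)\<close>: that column
    is replaced by the right-hand side.\<close>
  define N where "N K = (\<chi> p q. if q = (i, j) then vc (C K) $ p else M K $ p $ q)" for K
  have eq: "\<forall>\<^sub>F K in nhds a. X K $ i $ j = det (N K) / det (M K)"
    using ev
  proof eventually_elim
    case (elim K)
    then have "M K *v vc (X K) = vc (C K)" unfolding M_vc by simp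
    then have "vc (X K) $ (i, j) = det (N K) / det (M K)"
      unfolding cramer[OF det[OF conjunct1[OF elim]]] N_def by (simp add: vec_eq_iff)
    then show ?case by (simp add: vc_def)
  qed
  have M': "C11_at (\<lambda>K. M K $ p $ q) a" for p q
    unfolding M_def by (simp only: vec_lambda_beta, intro C11_at_diff C11_at_const C11_at_mult F)
  have N': "C11_at (\<lambda>K. N K $ p $ q) a" for p q
    unfolding N_def vc_def by (cases "q = (i, j)") (simp_all add: M' C)
  have "det (M a) \<noteq> 0" using det eventually_nhds_x_imp_x[OF ev] by blast
  with C11_at_det[OF N'] C11_at_det[OF M'] have "C11_at (\<lambda>K. det (N K) / det (M K)) a"
    by (rule C11_at_divide)
  with eq show ?thesis by (rule C11_at_cong)
qed

text \<open>Replace the rows of \<open>P\<close> outside an index set \<open>I\<close> by those of the identity. Subtracting \<open>t e\<^sub>i\<close> from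
  row \<open>i \<in> I\<close> leaves the matrix nonsingular for every \<open>t < 1\<close>, while its determinant is affine in \<open>t\<close>;
  so dropping \<open>i\<close> from \<open>I\<close> does not increase the determinant.\<close>

lemma det_ge_diagonal:
  fixes P :: "real ^ 'n ^ 'n"
  assumes P: "\<And>v. v \<bullet> (P *v v) \<ge> v \<bullet> v"
  shows "det P \<ge> P $ i0 $ i0" "P $ i0 $ i0 \<ge> 1"
proof -
  define D where "D I = (\<chi> i. if i \<in> I then P $ i else axis i 1)" for I
  show ge1: "P $ i0 $ i0 \<ge> 1"
    using P[of "axis i0 1"] by (simp add: inner_axis' inner_axis_axis matrix_vector_mult_basis column_def)
  have step: "det (D (insert i I)) \<ge> det (D I)" if i: "i \<notin> I" and pos: "det (D I) > 0" for i I
  proof (rule ccontr)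
    assume less: "\<not> det (D (insert i I)) \<ge> det (D I)"
    \<comment> \<open>The zero of the affine function det (D (insert i I)) - t det (D I); a drop of
      the determinant places it below 1.\<close>
    define t where "t = det (D (insert i I)) / det (D I)"
    have t: "t < 1" using less pos by (simp add: t_def)
    define E where "E = (\<chi> k. if k = i then P $ i + (- t) *s axis i 1 else D I $ k)"
    have "det E = det (\<chi> k. if k = i then P $ i else D I $ k) + det (\<chi> k. if k = i then (- t) *s axis i 1 else D I $ k)"
      unfolding E_def by (rule det_row_add)
    also have "det (\<chi> k. if k = i then (- t) *s axis i 1 else D I $ k) =
        - t * det (\<chi> k. if k = i then axis i 1 else D I $ k)"
      by (rule det_row_mul)
    also have "(\<chi> k. if k = i then axis i 1 else D I $ k) = D I"
      using i by (simp add: D_def vec_eq_iff)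
    also have "(\<chi> k. if k = i then P $ i else D I $ k) = D (insert i I)"
      using i by (auto simp: D_def vec_eq_iff)
    finally have "det E = 0" using pos by (simp add: t_def)
    then obtain v where v: "v \<noteq> 0" "E *v v = 0"
      unfolding invertible_det_nz[of E, simplified not_not, symmetric]
      by (metis invertible_det_nz invertible_left_inverse matrix_left_invertible_ker)
    have row: "E $ k \<bullet> v = 0" for k
      using v(2) by (simp add: vec_eq_iff matrix_vector_mul_component)
    \<comment> \<open>A null vector of E is orthogonal to row k of P for k in I and has v_k = 0 for
      k outside \<open>insert i I\<close>. Only index \<open>i\<close> contributes to v \<bullet>
      Pv, which is then too small for P \<ge> I.\<close>
    have vP: "v $ k * (P *v v) $ k = (if k = i then t * (v $ i)\<^sup>2 else 0)" for k
    proof -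
      consider "k = i" | "k \<noteq> i" "k \<in> I" | "k \<noteq> i" "k \<notin> I" by blast
      then show ?thesis
      proof cases
        case 1
        then show ?thesis using row[of k]
          by (simp add: E_def matrix_vector_mul_component inner_diff_left inner_axis' power2_eq_square scalar_mult_eq_scaleR)
      next
        case 2
        then show ?thesis using row[of k] by (simp add: E_def D_def matrix_vector_mul_component)
      next
        case 3
        then show ?thesis using row[of k] by (simp add: E_def D_def inner_axis')
      qed
    qed
    have "v \<bullet> v \<le> t * (v $ i)\<^sup>2"
      using P[of v] by (simp add: inner_vec_def[of v "P *v v"] vP)
    moreover have "(v $ i)\<^sup>2 \<le> v \<bullet> v"
      using component_le_norm_cart[of v i] by (simp add: power2_norm_eq_inner[symmetric] abs_le_square_iff[symmetric])
    ultimately have "v \<bullet> v \<le> 0"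
    proof (cases "t \<le> 0")
      case True
      then show ?thesis using \<open>v \<bullet> v \<le> t * (v $ i)\<^sup>2\<close> mult_nonpos_nonneg[OF True, of "(v $ i)\<^sup>2"] by simp
    next
      case False
      then have "t * (v $ i)\<^sup>2 \<le> t * (v \<bullet> v)" using \<open>(v $ i)\<^sup>2 \<le> v \<bullet> v\<close> by (intro mult_left_mono) auto
      then have "(1 - t) * (v \<bullet> v) \<le> 0" using \<open>v \<bullet> v \<le> t * (v $ i)\<^sup>2\<close> by (simp add: algebra_simps)
      then show ?thesis using t by (simp add: mult_le_0_iff)
    qed
    then show False using v(1) inner_gt_zero_iff[of v] by linarith
  qed
  have base: "det (D {i0}) = P $ i0 $ i0"
  proof -
    have "D {i0} = (\<chi> i. if i = i0 then (\<Sum>k\<in>UNIV. (P $ i0 $ k) *s row k (mat 1 :: real ^ 'n ^ 'n)) else row i (mat 1))"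
      by (auto simp: D_def vec_eq_iff row_def mat_def axis_def if_distrib cong: if_cong)
    then show ?thesis using cramer_lemma_transpose[of i0 "P $ i0" "mat 1"] by simp
  qed
  \<comment> \<open>Index \<open>i0\<close> enters before all others, so the monotone chain starts
    at the diagonal entry instead of at 1, the determinant of the identity.\<close>
  have "det (D (insert i0 I)) \<ge> P $ i0 $ i0" if "finite I" for I
    using that
  proof (induction I)
    case empty
    then show ?case using base by simp
  next
    case (insert i I)
    show ?case
    proof (cases "i = i0")
      case True
      then show ?thesis using insert by simp
    next
      case False
      then show ?thesis using insert step[of i "insert i0 I"] ge1 by (simp add: insert_commute)
    qed
  qed
  from this[of UNIV] show "det P \<ge> P $ i0 $ i0" by (simp add: D_def)
qed

section \<open>Positive semidefinite matrices: entries and traces\<close>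

lemma symmetric_inner:
  fixes N :: "real ^ 'n ^ 'n"
  assumes "transpose N = N" shows "u \<bullet> (N *v v) = v \<bullet> (N *v u)"
  by (metis assms dot_lmul_matrix inner_commute transpose_matrix_vector)

lemma symmetric_entry: "transpose N = N \<Longrightarrow> N $ i $ j = N $ j $ i"
  by (metis transpose_def vec_lambda_beta)

lemma mv_axis: "(N *v axis i (1 :: real)) $ j = N $ j $ i"
  by (simp add: matrix_vector_mult_basis column_def)

text \<open>Evaluate the form at the sum and at the difference of two unit vectors. The diagonal
  thus controls the whole matrix.\<close>

lemma psd_entry_bound:
  fixes N :: "real ^ 'n ^ 'n"
  assumes sym: "transpose N = N" and psd: "\<And>v. v \<bullet> (N *v v) \<ge> 0"
  shows "2 * \<bar>N $ i $ j\<bar> \<le> N $ i $ i + N $ j $ j"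
proof -
  have s: "N $ j $ i = N $ i $ j" by (rule symmetric_entry[OF sym])
  have "0 \<le> (axis i 1 + axis j 1) \<bullet> (N *v (axis i 1 + axis j 1))" by (rule psd)
  also have "\<dots> = N $ i $ i + N $ j $ j + 2 * N $ i $ j"
    by (simp add: matrix_vector_right_distrib inner_add_left mv_axis inner_axis' s)
  finally have 1: "0 \<le> N $ i $ i + N $ j $ j + 2 * N $ i $ j" .
  have "0 \<le> (axis i 1 - axis j 1) \<bullet> (N *v (axis i 1 - axis j 1))" by (rule psd)
  also have "\<dots> = N $ i $ i + N $ j $ j - 2 * N $ i $ j"
    by (simp add: matrix_vector_mult_diff_distrib inner_diff_left mv_axis inner_axis' s)
  finally show ?thesis using 1 by linarith
qed

text \<open>With a vanishing diagonal entry the form at e_j + t e_i is affine in t; a nonzero slope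
  lets it take the value -1.\<close>

lemma psd_row_0:
  fixes N :: "real ^ 'n ^ 'n"
  assumes sym: "transpose N = N" and psd: "\<And>v. v \<bullet> (N *v v) \<ge> 0" and "N $ i $ i = 0"
  shows "N $ i $ j = 0"
proof (rule ccontr)
  assume nz: "N $ i $ j \<noteq> 0"
  define t where "t = - (N $ j $ j + 1) / (2 * N $ i $ j)"
  have s: "N $ j $ i = N $ i $ j" by (rule symmetric_entry[OF sym])
  have "0 \<le> (axis j 1 + t *\<^sub>R axis i 1) \<bullet> (N *v (axis j 1 + t *\<^sub>R axis i 1))" by (rule psd)
  also have "\<dots> = N $ j $ j + 2 * t * N $ i $ j"
    using assms(3) by (simp add: matrix_vector_right_distrib matrix_vector_mult_scaleR inner_add_left mv_axis inner_axis' s)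
  also have "\<dots> = -1" using nz by (simp add: t_def field_simps)
  finally show False by simp
qed

lemma outer_mult_vector: "outer x *v v = (x \<bullet> v) *\<^sub>R x"
  by (simp add: vec_eq_iff outer_def matrix_vector_mult_def inner_vec_def sum_distrib_left sum_distrib_right mult.assoc mult.left_commute mult.commute)

text \<open>Eliminating one row and column of \<open>N\<close> (a Schur complement) splits off a rank-one matrix, and
  \<open>trace (M ** outer x) = x \<bullet> Mx\<close>.\<close>

lemma trace_mult_psd_nonneg:
  fixes M N :: "real ^ 'n ^ 'n"
  assumes M: "\<And>v. v \<bullet> (M *v v) \<ge> 0"
    and "transpose N = N" "\<And>v. v \<bullet> (N *v v) \<ge> 0"
  shows "trace (M ** N) \<ge> 0"
  using assms(2,3)
proof (induction "card {i. N $ i \<noteq> 0}" arbitrary: N rule: less_induct)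
  case less
  show ?case
  proof (cases "\<exists>i. N $ i \<noteq> 0")
    case False
    then have "N = 0" by (simp add: vec_eq_iff)
    then show ?thesis by (simp add: trace_def)
  next
    case True
    then obtain i where i: "N $ i \<noteq> 0" by blast
    define d where "d = N $ i $ i"
    have "d \<noteq> 0" using i psd_row_0[OF less.prems, of i] by (auto simp: d_def vec_eq_iff)
    moreover have "d \<ge> 0" using less.prems(2)[of "axis i 1"] by (simp add: mv_axis inner_axis' d_def)
    ultimately have d: "d > 0" by simp
    define x where "x = N *v axis i 1"
    have x: "x $ j = N $ j $ i" for j by (simp add: x_def mv_axis inner_axis')
    define N' where "N' = N - (1 / d) *\<^sub>R outer x"
    have N': "N' $ k $ j = N $ k $ j - N $ k $ i * N $ j $ i / d" for k j
      by (simp add: N'_def outer_def x)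
    \<comment> \<open>Rows that vanish stay zero and row \<open>i\<close> becomes zero, so the
      number of nonzero rows drops.\<close>
    have sub: "{k. N' $ k \<noteq> 0} \<subset> {k. N $ k \<noteq> 0}"
    proof
      show "{k. N' $ k \<noteq> 0} \<subseteq> {k. N $ k \<noteq> 0}"
      proof -
        have "N' $ k = 0" if "N $ k = 0" for k using that by (simp add: vec_eq_iff N')
        then show ?thesis by blast
      qed
      have "N' $ i = 0" using d symmetric_entry[OF less.prems(1)] by (auto simp: vec_eq_iff N' d_def)
      then show "{k. N' $ k \<noteq> 0} \<noteq> {k. N $ k \<noteq> 0}" using i by blast
    qed
    have "trace (M ** N') \<ge> 0"
    proof (rule less.hyps)
      show "card {k. N' $ k \<noteq> 0} < card {k. N $ k \<noteq> 0}" by (rule psubset_card_mono[OF _ sub]) simp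
      show "transpose N' = N'"
        by (simp add: vec_eq_iff transpose_def N' symmetric_entry[OF less.prems(1)] mult.commute)
      fix v
      have xv: "axis i 1 \<bullet> (N *v v) = x \<bullet> v"
        unfolding x_def using symmetric_inner[OF less.prems(1)] by (metis inner_commute)
      let ?t = "(x \<bullet> v) / d"
      \<comment> \<open>This shift minimizes the form of N along e_i; the minimum is the form of the
        Schur complement at \<open>v\<close>.\<close>
      have "0 \<le> (v - ?t *\<^sub>R axis i 1) \<bullet> (N *v (v - ?t *\<^sub>R axis i 1))" by (rule less.prems)
      also have "\<dots> = v \<bullet> (N *v v) - 2 * ?t * (x \<bullet> v) + ?t * ?t * d"
        using xv by (simp add: matrix_vector_mult_diff_distrib matrix_vector_mult_scaleR inner_diff_left inner_diff_right
            x_def[symmetric] inner_commute[of v x] inner_axis' x d_def)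
      also have "\<dots> = v \<bullet> (N' *v v)"
        using d by (simp add: N'_def matrix_vector_mult_diff_rdistrib scaleR_matrix_vector_assoc[symmetric] outer_mult_vector
            inner_diff_right inner_commute[of v x])
      finally show "0 \<le> v \<bullet> (N' *v v)" .
    qed
    moreover have "trace (M ** outer x) = x \<bullet> (M *v x)"
      by (simp add: trace_def matrix_matrix_mult_def outer_def inner_vec_def matrix_vector_mult_def sum_distrib_left mult.assoc mult.left_commute mult.commute)
    moreover have "trace (M ** N) = trace (M ** N') + (1 / d) * trace (M ** outer x)"
      by (simp add: N'_def trace_def matrix_matrix_mult_def sum_distrib_left sum.distrib[symmetric] algebra_simps)
    ultimately show ?thesis using M[of x] d by simp
  qed
qed

text \<open>The constant is the minimum of the form on the unit sphere, attained by compactness;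
  homogeneity extends the bound to all vectors. The vector \<open>axis undefined 1\<close> only
  witnesses that the sphere is nonempty.\<close>

lemma pos_def_coercive:
  fixes M :: "real ^ 'n ^ 'n"
  assumes "pos_def M"
  obtains c where "c > 0" "\<And>v. v \<bullet> (M *v v) \<ge> c * (v \<bullet> v)"
proof -
  have "compact (sphere (0 :: real ^ 'n) 1)" by simp
  moreover have "axis undefined 1 \<in> sphere (0 :: real ^ 'n) 1" by (simp add: norm_axis_1)
  moreover have "continuous_on (sphere 0 1) (\<lambda>v. v \<bullet> (M *v v))"
    by (intro continuous_intros matrix_vector_mult_linear_continuous_on)
  ultimately obtain w where w: "w \<in> sphere 0 1" "\<And>v. v \<in> sphere 0 1 \<Longrightarrow> w \<bullet> (M *v w) \<le> v \<bullet> (M *v v)"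
    using continuous_attains_inf[of "sphere 0 1" "\<lambda>v. v \<bullet> (M *v v)"] by blast
  show ?thesis
  proof (rule that[of "w \<bullet> (M *v w)"])
    show "w \<bullet> (M *v w) > 0" using assms w(1) unfolding pos_def_def by (metis mem_sphere_0 norm_zero zero_neq_one)
    fix v :: "real ^ 'n"
    show "v \<bullet> (M *v v) \<ge> (w \<bullet> (M *v w)) * (v \<bullet> v)"
    proof (cases "v = 0")
      case False
      then have "w \<bullet> (M *v w) \<le> (v /\<^sub>R norm v) \<bullet> (M *v (v /\<^sub>R norm v))" by (intro w(2)) simp
      also have "\<dots> = (v \<bullet> (M *v v)) / (v \<bullet> v)"
        by (simp add: matrix_vector_mult_scaleR power2_norm_eq_inner[symmetric] power2_eq_square divide_inverse)
      finally show ?thesis using False by (simp add: pos_le_divide_eq)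
    qed simp
  qed
qed

lemma norm_matrix_squared: "(norm (K :: real ^ 'n ^ 'm))\<^sup>2 = (\<Sum>i\<in>UNIV. \<Sum>j\<in>UNIV. (K $ i $ j)\<^sup>2)"
  by (simp only: power2_norm_eq_inner inner_vec_def) (simp add: power2_eq_square)

text \<open>The trace sums the form of R over the columns of K, whose squared lengths add up to the
  squared Frobenius norm.\<close>

lemma trace_congruence_ge:
  fixes K :: "real ^ 'n ^ 'm" and R :: "real ^ 'm ^ 'm"
  assumes "\<And>v. v \<bullet> (R *v v) \<ge> r * (v \<bullet> v)"
  shows "trace (transpose K ** R ** K) \<ge> r * (norm K)\<^sup>2"
proof -
  have "trace (transpose K ** R ** K) = (\<Sum>j\<in>UNIV. axis j 1 \<bullet> ((transpose K ** R ** K) *v axis j 1))"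
    by (simp add: trace_def mv_axis inner_axis')
  also have "\<dots> \<ge> (\<Sum>j\<in>UNIV. r * ((K *v axis j 1) \<bullet> (K *v axis j 1)))"
    unfolding inner_congruence by (intro sum_mono assms)
  also have "(\<Sum>j\<in>UNIV. r * ((K *v axis j 1) \<bullet> (K *v axis j 1))) = r * (norm K)\<^sup>2"
    unfolding norm_matrix_squared sum_distrib_left[symmetric]
    by (subst sum.swap) (simp add: inner_vec_def mv_axis inner_axis' power2_eq_square)
  finally show ?thesis .
qed

section \<open>Armijo descent on a compact sublevel set\<close>

text \<open>A Lebesgue number argument: cover S by finitely many balls of half the local radius, so
  that a point in a half ball and any point close to it both lie in the full ball. Including y \<in>
  D lets later trial steps remain in the domain.\<close>

lemma C11_at_uniform_on_compact:
  fixes f :: "'a::real_inner \<Rightarrow> real"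
  assumes "compact S" "S \<subseteq> D" "open D" and C11: "\<And>x. x \<in> D \<Longrightarrow> C11_at f x"
  obtains C d where "C > 0" "d > 0" "\<And>x. x \<in> S \<Longrightarrow> norm (gradient f x) \<le> C"
    "\<And>x y. x \<in> S \<Longrightarrow> dist x y < d \<Longrightarrow>
      y \<in> D \<and> \<bar>f y - f x - gradient f x \<bullet> (y - x)\<bar> \<le> C * (norm (y - x))\<^sup>2"
proof -
  have "\<exists>d C. d > 0 \<and> (\<forall>x y. dist a x < d \<longrightarrow> dist a y < d \<longrightarrow> y \<in> D \<and> norm (gradient f x) \<le> C \<and>
      \<bar>f y - f x - gradient f x \<bullet> (y - x)\<bar> \<le> C * (norm (y - x))\<^sup>2)" if "a \<in> S" for a
  proof -
    have "a \<in> D" using that assms(2) by blast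
    obtain g C d where g: "d > 0"
      "\<And>x y. \<lbrakk>dist a x < d; dist a y < d\<rbrakk> \<Longrightarrow> norm (g x) \<le> C \<and> \<bar>f y - f x - g x \<bullet> (y - x)\<bar> \<le> C * (norm (y - x))\<^sup>2"
      "\<And>x. dist a x < d \<Longrightarrow> GDERIV f x :> g x"
      by (rule C11_at_uniform[OF C11[OF \<open>a \<in> D\<close>]]) blast
    obtain e where e: "e > 0" "ball a e \<subseteq> D"
      using \<open>open D\<close> \<open>a \<in> D\<close> unfolding open_contains_ball by blast
    show ?thesis
      by (rule exI[of _ "min d e"], rule exI[of _ C]) (use g e gradient_eq[OF g(3)] in auto)
  qed
  then obtain d C where dC: "\<And>a. a \<in> S \<Longrightarrow> d a > 0"
      "\<And>a x y. a \<in> S \<Longrightarrow> dist a x < d a \<Longrightarrow> dist a y < d a \<Longrightarrow> y \<in> D \<and> norm (gradient f x) \<le> C a \<and>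
      \<bar>f y - f x - gradient f x \<bullet> (y - x)\<bar> \<le> C a * (norm (y - x))\<^sup>2"
    by metis
  have "S \<subseteq> (\<Union>a\<in>S. ball a (d a / 2))" using dC(1) by force
  then obtain T where T: "T \<subseteq> S" "finite T" "S \<subseteq> (\<Union>a\<in>T. ball a (d a / 2))"
    by (rule compactE_image[OF \<open>compact S\<close>, rotated]) auto
  \<comment> \<open>Inserting 1 keeps the minimum meaningful when the finite cover is empty.\<close>
  define r where "r = Min (insert 1 ((\<lambda>a. d a / 2) ` T))"
  define c where "c = 1 + (\<Sum>a\<in>T. \<bar>C a\<bar>)"
  have r: "r > 0" unfolding r_def using T dC(1) by (subst Min_gr_iff) auto
  have c: "c > 0" unfolding c_def by (simp add: add_pos_nonneg sum_nonneg)
  have main: "y \<in> D \<and> norm (gradient f x) \<le> c \<and> \<bar>f y - f x - gradient f x \<bullet> (y - x)\<bar> \<le> c * (norm (y - x))\<^sup>2"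
    if "x \<in> S" "dist x y < r" for x y
  proof -
    have "x \<in> (\<Union>a\<in>T. ball a (d a / 2))" using T(3) that(1) by blast
    then obtain a where a: "a \<in> T" "dist a x < d a / 2" by auto
    have "a \<in> S" using a T by blast
    have "r \<le> d a / 2" unfolding r_def using a T(2) by (intro Min_le) auto
    then have "dist a y < d a" using a(2) that(2) dist_triangle[of a y x] by linarith
    moreover have "dist a x < d a" using a(2) dC(1)[OF \<open>a \<in> S\<close>] by linarith
    moreover have "C a \<le> c"
      using member_le_sum[OF a(1), of "\<lambda>a. \<bar>C a\<bar>"] T(2) unfolding c_def by simp
    moreover from this have "C a * (norm (y - x))\<^sup>2 \<le> c * (norm (y - x))\<^sup>2"
      by (intro mult_right_mono) auto
    ultimately show ?thesis using dC(2)[OF \<open>a \<in> S\<close>, of x y] by linarith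
  qed
  show ?thesis using that[of c r] main r c by (metis dist_self)
qed

lemma backtrack_first:
  assumes "armijo f g \<tau> x (\<eta>\<^sub>0 * \<beta> ^ j)"
  obtains i where "backtrack f g \<tau> \<eta>\<^sub>0 \<beta> x = \<eta>\<^sub>0 * \<beta> ^ i" "armijo f g \<tau> x (\<eta>\<^sub>0 * \<beta> ^ i)"
    "\<And>k. k < i \<Longrightarrow> \<not> armijo f g \<tau> x (\<eta>\<^sub>0 * \<beta> ^ k)"
  using that[of "LEAST j. armijo f g \<tau> x (\<eta>\<^sub>0 * \<beta> ^ j)"] LeastI[of _ j] not_less_Least assms
  unfolding backtrack_def by (metis (no_types, lifting))

text \<open>Independent of the control problem: the objective enters through its compact sublevel
  set, its open domain and the remainder bound. The value \<infinity> outside D makes the Armijo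
  test reject every trial point that leaves D.\<close>

lemma armijo_descent:
  fixes F :: "'a::real_inner \<Rightarrow> ereal" and x :: "nat \<Rightarrow> 'a" and \<eta> :: "nat \<Rightarrow> real"
    and \<beta> \<tau> \<eta>\<^sub>0 :: real
  defines "f \<equiv> \<lambda>y. real_of_ereal (F y)"
  defines "g \<equiv> gradient f" and "S \<equiv> {y. F y \<le> F (x 0)}"
  assumes F: "\<And>y. y \<in> D \<Longrightarrow> F y = ereal (f y)" "\<And>y. y \<notin> D \<Longrightarrow> F y = \<infinity>"
    and "open D" and C11: "\<And>y. y \<in> D \<Longrightarrow> C11_at f y" and "compact S" and x0: "x 0 \<in> D"
    and \<beta>: "0 < \<beta>" "\<beta> < 1" and \<tau>: "0 < \<tau>" "\<tau> < 1" and \<eta>0: "0 < \<eta>\<^sub>0"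
    and \<eta>: "\<And>k. \<eta> k = backtrack F g \<tau> \<eta>\<^sub>0 \<beta> (x k)"
    and x: "\<And>k. x (Suc k) = x k - \<eta> k *\<^sub>R g (x k)"
  shows "(\<forall>k. \<exists>j. armijo F g \<tau> (x k) (\<eta>\<^sub>0 * \<beta> ^ j)) \<and>
    (\<exists>\<eta>\<^sub>m > 0. (\<forall>k. x k \<in> S) \<and> S \<subseteq> D \<and> (\<forall>k. \<eta> k \<ge> \<eta>\<^sub>m) \<and>
       (\<lambda>k. norm (g (x k))) \<longlonglongrightarrow> 0 \<and>
       (\<forall>N. ereal (Min ((\<lambda>k. (norm (g (x k)))\<^sup>2) ` {0..N}))
              \<le> (F (x 0) - (INF y\<in>S. F y)) / ereal (\<tau> * \<eta>\<^sub>m * (real N + 1))) \<and>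
       (\<lambda>N. Min ((\<lambda>k. (norm (g (x k)))\<^sup>2) ` {0..N})) \<in> O(\<lambda>N. 1 / real N))"
proof -
  have SD: "S \<subseteq> D"
  proof
    fix y assume "y \<in> S"
    then show "y \<in> D" using F(1)[OF x0] F(2)[of y] unfolding S_def by (cases "y \<in> D") auto
  qed
  obtain C d where C: "C > 0" and d: "d > 0" and gC: "\<And>y. y \<in> S \<Longrightarrow> norm (g y) \<le> C"
    and quad: "\<And>y z. y \<in> S \<Longrightarrow> dist y z < d \<Longrightarrow>
      z \<in> D \<and> \<bar>f z - f y - g y \<bullet> (z - y)\<bar> \<le> C * (norm (z - y))\<^sup>2"
    unfolding g_def
    by (rule C11_at_uniform_on_compact[OF \<open>compact S\<close> SD \<open>open D\<close> C11]) blast+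
  \<comment> \<open>The first bound keeps the displacement at most d/2, inside the radius of the
    remainder estimate. The second gives C t \<le> 1 - \<tau>, so the remainder uses up no more than
    the fraction 1 - \<tau> of the linear decrease.\<close>
  define h where "h = min (d / (2 * C)) ((1 - \<tau>) / C)"
  have h: "h > 0" using C d \<tau> by (simp add: h_def)
  have small: "armijo F g \<tau> y t" if y: "y \<in> S" and t: "0 < t" "t \<le> h" for y t
  proof -
    let ?n = "norm (g y)"
    have "t * ?n \<le> (d / (2 * C)) * C"
      using t gC[OF y] C d by (intro mult_mono) (auto simp: h_def)
    also have "\<dots> < d" using C d by simp
    finally have "dist y (y - t *\<^sub>R g y) < d" using t by (simp add: dist_norm)
    from quad[OF y this] have z: "y - t *\<^sub>R g y \<in> D"
      and q: "\<bar>f (y - t *\<^sub>R g y) - f y + t * ?n\<^sup>2\<bar> \<le> C * (t * ?n)\<^sup>2"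
      using t by (auto simp: power2_norm_eq_inner)
    have "t * C \<le> 1 - \<tau>" using t C by (simp add: h_def pos_le_divide_eq)
    then have "(t * C) * (t * ?n\<^sup>2) \<le> (1 - \<tau>) * (t * ?n\<^sup>2)"
      using t by (intro mult_right_mono) auto
    then have "f (y - t *\<^sub>R g y) \<le> f y - \<tau> * t * ?n\<^sup>2"
      using q by (simp add: algebra_simps power2_eq_square)
    then show ?thesis
      unfolding armijo_def using F(1)[OF z] F(1)[of y] y SD by auto
  qed
  have ex: "\<exists>j. armijo F g \<tau> y (\<eta>\<^sub>0 * \<beta> ^ j)" if "y \<in> S" for y
  proof -
    have "h / \<eta>\<^sub>0 > 0" using h \<eta>0 by simp
    then obtain j where "\<beta> ^ j < h / \<eta>\<^sub>0" using real_arch_pow_inv \<beta>(2) by blast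
    then have "\<eta>\<^sub>0 * \<beta> ^ j \<le> h" using \<eta>0 by (simp add: field_simps)
    then show ?thesis using small[OF that] \<eta>0 \<beta> by (metis mult_pos_pos zero_less_power)
  qed
  \<comment> \<open>Either the initial trial is accepted, or the trial just before the accepted one
    was rejected, hence exceeded \<open>h\<close>, and one factor \<beta> is lost.\<close>
  define \<eta>m where "\<eta>m = min \<eta>\<^sub>0 (\<beta> * h)"
  have \<eta>m: "\<eta>m > 0" using \<eta>0 \<beta> h by (simp add: \<eta>m_def)
  have bt: "armijo F g \<tau> y (backtrack F g \<tau> \<eta>\<^sub>0 \<beta> y) \<and> backtrack F g \<tau> \<eta>\<^sub>0 \<beta> y \<ge> \<eta>m" if y: "y \<in> S" for y
  proof -
    obtain j where "armijo F g \<tau> y (\<eta>\<^sub>0 * \<beta> ^ j)" using ex[OF y] by blast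
    then obtain i where i: "backtrack F g \<tau> \<eta>\<^sub>0 \<beta> y = \<eta>\<^sub>0 * \<beta> ^ i" "armijo F g \<tau> y (\<eta>\<^sub>0 * \<beta> ^ i)"
      "\<And>k. k < i \<Longrightarrow> \<not> armijo F g \<tau> y (\<eta>\<^sub>0 * \<beta> ^ k)"
      by (rule backtrack_first) blast
    have "\<eta>\<^sub>0 * \<beta> ^ i \<ge> \<eta>m"
    proof (cases i)
      case 0
      then show ?thesis by (simp add: \<eta>m_def)
    next
      case (Suc k)
      have "\<eta>\<^sub>0 * \<beta> ^ k > h"
        using i(3)[of k] small[OF y, of "\<eta>\<^sub>0 * \<beta> ^ k"] Suc \<eta>0 \<beta> by force
      then have "\<beta> * h \<le> \<eta>\<^sub>0 * \<beta> ^ i" using \<beta> Suc by (simp add: mult.left_commute)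
      then show ?thesis by (simp add: \<eta>m_def)
    qed
    then show ?thesis using i by simp
  qed
  have dec: "x (Suc k) \<in> D \<and> f (x (Suc k)) \<le> f (x k) - \<tau> * \<eta> k * (norm (g (x k)))\<^sup>2" if "x k \<in> S" for k
  proof -
    have "x k \<in> D" using that SD by blast
    have *: "F (x (Suc k)) \<le> ereal (f (x k) - \<tau> * \<eta> k * (norm (g (x k)))\<^sup>2)"
      using bt[OF that] F(1)[OF \<open>x k \<in> D\<close>] unfolding \<eta>[symmetric] armijo_def x by simp
    then have "x (Suc k) \<in> D" using F(2)[of "x (Suc k)"] by (cases "x (Suc k) \<in> D") auto
    then show ?thesis using * F(1) by simp
  qed
  have xS: "x k \<in> S" for k
  proof (induction k)
    case 0
    then show ?case by (simp add: S_def)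
  next
    case (Suc k)
    have "\<eta> k \<ge> \<eta>m" using bt[OF Suc] \<eta> by simp
    then have "\<tau> * \<eta> k * (norm (g (x k)))\<^sup>2 \<ge> 0" using \<eta>m \<tau> by simp
    then have "f (x (Suc k)) \<le> f (x k)" using dec[OF Suc] by linarith
    then have "F (x (Suc k)) \<le> F (x k)" using dec[OF Suc] F(1) Suc SD by auto
    then show ?case using Suc unfolding S_def by auto
  qed
  have \<eta>ge: "\<eta> k \<ge> \<eta>m" for k using bt[OF xS] \<eta> by simp
  have sum: "(\<Sum>k\<le>N. \<tau> * \<eta>m * (norm (g (x k)))\<^sup>2) \<le> f (x 0) - f (x (Suc N))" for N
  proof (induction N)
    case 0
    have "\<tau> * \<eta>m * (norm (g (x 0)))\<^sup>2 \<le> \<tau> * \<eta> 0 * (norm (g (x 0)))\<^sup>2"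
      using \<eta>ge \<tau> by (intro mult_right_mono mult_left_mono) auto
    then show ?case using dec[OF xS, of 0] by simp
  next
    case (Suc N)
    have "\<tau> * \<eta>m * (norm (g (x (Suc N))))\<^sup>2 \<le> \<tau> * \<eta> (Suc N) * (norm (g (x (Suc N))))\<^sup>2"
      using \<eta>ge \<tau> by (intro mult_right_mono mult_left_mono) auto
    then show ?case using dec[OF xS, of "Suc N"] Suc by simp
  qed
  have "continuous_on S f"
    using C11 SD C11_at_isCont by (metis continuous_at_imp_continuous_on subset_iff)
  then obtain w where w: "w \<in> S" "\<And>y. y \<in> S \<Longrightarrow> f w \<le> f y"
    using continuous_attains_inf[OF \<open>compact S\<close>, of f] xS by blast
  define \<Delta> where "\<Delta> = f (x 0) - f w"
  have FS: "F y = ereal (f y)" if "y \<in> S" for y using that SD F(1) by blast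
  \<comment> \<open>The infimum is attained, so the extended real subtraction in the rate involves
    only finite values.\<close>
  have inf: "(INF y\<in>S. F y) = ereal (f w)"
  proof (rule antisym)
    show "(INF y\<in>S. F y) \<le> ereal (f w)" using INF_lower[OF w(1), of F] FS[OF w(1)] by simp
    show "ereal (f w) \<le> (INF y\<in>S. F y)" by (rule INF_greatest) (simp add: FS w(2))
  qed
  have sum2: "(\<Sum>k\<le>N. \<tau> * \<eta>m * (norm (g (x k)))\<^sup>2) \<le> \<Delta>" for N
    using sum[of N] w(2)[OF xS[of "Suc N"]] unfolding \<Delta>_def by linarith
  have min: "Min ((\<lambda>k. (norm (g (x k)))\<^sup>2) ` {0..N}) \<le> \<Delta> / (\<tau> * \<eta>m * (real N + 1))" for N
  proof -
    let ?m = "Min ((\<lambda>k. (norm (g (x k)))\<^sup>2) ` {0..N})"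
    \<comment> \<open>The minimum of N + 1 terms is at most their average.\<close>
    have "(\<Sum>k\<le>N. \<tau> * \<eta>m * ?m) \<le> (\<Sum>k\<le>N. \<tau> * \<eta>m * (norm (g (x k)))\<^sup>2)"
      using \<tau> \<eta>m by (intro sum_mono mult_left_mono Min_le) auto
    then have "?m * (\<tau> * \<eta>m * (real N + 1)) \<le> \<Delta>" using sum2[of N] by (simp add: algebra_simps)
    then show ?thesis using \<tau> \<eta>m by (subst pos_le_divide_eq) (auto intro!: mult_pos_pos)
  qed
  have lim: "(\<lambda>k. norm (g (x k))) \<longlonglongrightarrow> 0"
  proof -
    have "summable (\<lambda>k. \<tau> * \<eta>m * (norm (g (x k)))\<^sup>2)"
      by (rule bounded_imp_summable[of _ \<Delta>]) (use \<tau> \<eta>m sum2 in auto)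
    from summable_LIMSEQ_zero[OF this]
    have "(\<lambda>k. (\<tau> * \<eta>m * (norm (g (x k)))\<^sup>2) / (\<tau> * \<eta>m)) \<longlonglongrightarrow> 0 / (\<tau> * \<eta>m)"
      by (intro tendsto_divide tendsto_const) (use \<tau> \<eta>m in auto)
    then have "(\<lambda>k. (norm (g (x k)))\<^sup>2) \<longlonglongrightarrow> 0" using \<tau> \<eta>m by simp
    from tendsto_real_sqrt[OF this] show ?thesis by simp
  qed
  have rate: "(\<lambda>N. Min ((\<lambda>k. (norm (g (x k)))\<^sup>2) ` {0..N})) \<in> O(\<lambda>N. 1 / real N)"
  proof (rule bigoI[where c = "\<Delta> / (\<tau> * \<eta>m)"])
    \<comment> \<open>Restricted to positive N: at N = 0 the comparison function is 1/0 = 0 by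
      convention.\<close>
    have "norm (Min ((\<lambda>k. (norm (g (x k)))\<^sup>2) ` {0..N})) \<le> \<Delta> / (\<tau> * \<eta>m) * norm (1 / real N)" if "N > 0" for N
    proof -
      have "Min ((\<lambda>k. (norm (g (x k)))\<^sup>2) ` {0..N}) \<ge> 0" by (subst Min_ge_iff) auto
      moreover have "\<Delta> \<ge> 0" using w(2)[OF xS[of 0]] by (simp add: \<Delta>_def)
      then have "\<Delta> / (\<tau> * \<eta>m * (real N + 1)) \<le> \<Delta> / (\<tau> * \<eta>m * real N)"
        using \<tau> \<eta>m that by (intro divide_left_mono mult_left_mono mult_pos_pos) auto
      ultimately show ?thesis using min[of N] by simp
    qed
    then show "\<forall>\<^sub>F N in sequentially. norm (Min ((\<lambda>k. (norm (g (x k)))\<^sup>2) ` {0..N})) \<le> \<Delta> / (\<tau> * \<eta>m) * norm (1 / real N)"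
      using eventually_gt_at_top[of 0] by (rule eventually_mono[rotated])
  qed
  have "ereal (Min ((\<lambda>k. (norm (g (x k)))\<^sup>2) ` {0..N}))
      \<le> (F (x 0) - (INF y\<in>S. F y)) / ereal (\<tau> * \<eta>m * (real N + 1))" for N
    unfolding inf F(1)[OF x0] using min[of N] \<tau> \<eta>m by (simp add: \<Delta>_def)
  then show ?thesis using ex xS SD \<eta>ge lim rate \<eta>m by blast
qed

section \<open>The penalized mean-variance objective\<close>

lemma D_stab_power_null: "K \<in> D_stab A B \<Longrightarrow> power_null (closed_loop A B K)"
  unfolding D_stab_def by (simp add: power_null_of_spectral_radius)

lemma P_sol_stein:
  assumes "K \<in> D_stab A B" "0 < \<gamma>" "\<gamma> < 1"
  shows "stein \<gamma> (closed_loop A B K) (P_sol A B Q R \<gamma> K) = Q + transpose K ** R ** K"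
proof -
  have "\<exists>!X. stein \<gamma> (closed_loop A B K) X = Q + transpose K ** R ** K"
    using assms by (intro stein_ex1 D_stab_power_null) auto
  from theI'[OF this] show ?thesis unfolding P_sol_def stein_def .
qed

lemma Z_sol_stein:
  assumes "K \<in> D_stab A B" "0 < \<gamma>" "\<gamma> < 1"
  shows "stein (\<gamma>\<^sup>2) (transpose (closed_loop A B K)) (Z_sol A B \<Sigma> x \<gamma> K) =
    closed_loop A B K ** (outer x + (\<gamma>\<^sup>2 / (1 - \<gamma>\<^sup>2)) *\<^sub>R \<Sigma>) ** transpose (closed_loop A B K)"
proof -
  have "\<gamma>\<^sup>2 \<le> 1" using assms by (simp add: power_le_one)
  then have "\<exists>!X. stein (\<gamma>\<^sup>2) (transpose (closed_loop A B K)) X =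
      closed_loop A B K ** (outer x + (\<gamma>\<^sup>2 / (1 - \<gamma>\<^sup>2)) *\<^sub>R \<Sigma>) ** transpose (closed_loop A B K)"
    using assms by (intro stein_ex1 power_null_transpose D_stab_power_null) auto
  from theI'[OF this] show ?thesis unfolding Z_sol_def stein_def transpose_transpose .
qed

lemma Pt_sol_stein:
  assumes "K \<in> D_stab A B"
  shows "stein 1 (closed_loop A B K) (Pt_sol A B K) = mat 1"
proof -
  have "\<exists>!X. stein 1 (closed_loop A B K) X = mat 1"
    using assms by (intro stein_ex1 D_stab_power_null) auto
  from theI'[OF this] show ?thesis unfolding Pt_sol_def stein_def scaleR_one .
qed

lemma Pt_sol_symmetric:
  assumes "K \<in> D_stab A B" shows "transpose (Pt_sol A B K) = Pt_sol A B K"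
  by (rule stein_symmetric[OF D_stab_power_null[OF assms] _ _ Pt_sol_stein[OF assms]]) (auto simp: transpose_mat)

lemma Pt_sol_ge:
  assumes "K \<in> D_stab A B" shows "v \<bullet> (Pt_sol A B K *v v) \<ge> v \<bullet> v"
  using stein_psd[OF D_stab_power_null[OF assms] _ _ Pt_sol_stein[OF assms], of v] by simp

text \<open>Makes the penalty nonnegative, so together with J \<ge> 0 a bound on the objective
  bounds cost and penalty separately.\<close>

lemma det_Pt_sol_ge_1:
  assumes "K \<in> D_stab A B" shows "det (Pt_sol A B K) \<ge> 1"
  using det_ge_diagonal[OF Pt_sol_ge[OF assms]] order.trans by blast

text \<open>By the equation, the form of P drops by v \<bullet> v along F. Both hypotheses are
  closed in the pair (K, P), so limits of certified gains are again stabilizing.\<close>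

lemma D_stabI:
  assumes P: "stein 1 (closed_loop A B K) P = mat 1" "\<And>v. v \<bullet> (P *v v) \<ge> v \<bullet> v"
  shows "K \<in> D_stab A B"
  unfolding D_stab_def
proof (rule CollectI, rule spectral_radius_less_1_of_lyapunov[where P = P])
  show "0 \<le> v \<bullet> (P *v v)" for v using P(2)[of v] inner_ge_zero[of v] by linarith
  show "(closed_loop A B K *v v) \<bullet> (P *v (closed_loop A B K *v v)) < v \<bullet> (P *v v)" if "v \<noteq> 0" for v
    using inner_stein[of v 1 "closed_loop A B K" P v] P(1) that inner_gt_zero_iff[of v] by simp
qed

section \<open>Continuity and openness of the stable region\<close>

lemma norm_matrix_vector_mult_le:
  fixes M :: "real ^ 'n ^ 'm" shows "norm (M *v v) \<le> norm M * norm v"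
proof -
  have "(norm (M *v v))\<^sup>2 = (\<Sum>i\<in>UNIV. (M $ i \<bullet> v)\<^sup>2)"
    by (simp only: power2_norm_eq_inner inner_vec_def[of "M *v v"])
      (simp add: matrix_vector_mul_component power2_eq_square)
  also have "\<dots> \<le> (\<Sum>i\<in>UNIV. (norm (M $ i))\<^sup>2 * (norm v)\<^sup>2)"
    using Cauchy_Schwarz_ineq by (intro sum_mono) (simp add: power2_norm_eq_inner)
  also have "\<dots> = (norm M * norm v)\<^sup>2"
    by (simp only: power_mult_distrib power2_norm_eq_inner[of M] inner_vec_def[of M] sum_distrib_right)
      (simp add: power2_norm_eq_inner)
  finally show ?thesis by (rule power2_le_imp_le) simp
qed

lemma C11_at_closed_loop: "C11_at (\<lambda>K. closed_loop A B K $ i $ j) a"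
  unfolding closed_loop_def
  by (simp only: vector_add_component, intro C11_at_add C11_at_const C11_at_matrix_mult C11_at_entry)

lemma isCont_closed_loop: "isCont (closed_loop A B) K"
proof -
  have "isCont (\<lambda>K. closed_loop A B K $ i $ j) K" for i j
    by (rule C11_at_isCont[OF C11_at_closed_loop])
  then show ?thesis unfolding isCont_def by (intro vec_tendstoI)
qed

lemma isCont_matrix_mult:
  fixes M :: "'a::t2_space \<Rightarrow> real ^ 'n ^ 'm" and N :: "'a \<Rightarrow> real ^ 'k ^ 'n"
  assumes "isCont M a" "isCont N a" shows "isCont (\<lambda>x. M x ** N x) a"
  using assms unfolding isCont_def matrix_matrix_mult_def
  by (intro vec_tendstoI) (simp, intro tendsto_intros, auto)

lemma isCont_transpose:
  fixes M :: "'a::t2_space \<Rightarrow> real ^ 'n ^ 'm"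
  assumes "isCont M a" shows "isCont (\<lambda>x. transpose (M x)) a"
  using assms unfolding isCont_def transpose_def
  by (intro vec_tendstoI) (simp, intro tendsto_intros)

text \<open>Joint continuity serves twice: with P fixed it gives openness of the stable region, and
  in the pair it gives closedness of the set of certified gains.\<close>

lemma isCont_stein_closed_loop:
  "isCont (\<lambda>p. stein 1 (closed_loop A B (fst p)) (snd p)) p"
proof -
  have c: "isCont (\<lambda>p. closed_loop A B (fst p)) p"
    by (rule isCont_o2[OF _ isCont_closed_loop]) (intro continuous_intros)
  show ?thesis unfolding stein_def
    by (intro continuous_intros isCont_matrix_mult isCont_transpose c)
qed

text \<open>\<open>Pt_sol A B K\<close> remains a Lyapunov certificate for all gains near \<open>K\<close>.\<close>

lemma open_D_stab:
  fixes A :: "real ^ 'n ^ 'n"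
  shows "open (D_stab A B)"
  unfolding open_dist
proof
  fix K assume K: "K \<in> D_stab A B"
  let ?P = "Pt_sol A B K"
  define S where "S L = stein 1 (closed_loop A B L) ?P" for L
  have "isCont S K"
    unfolding S_def using isCont_o2[OF _ isCont_stein_closed_loop, of K "\<lambda>L. (L, ?P)" A B]
    by (simp add: continuous_intros)
  then obtain e where e: "e > 0" "\<And>L. dist L K < e \<Longrightarrow> dist (S L) (S K) < 1"
    unfolding continuous_at_eps_delta by (metis zero_less_one)
  have "L \<in> D_stab A B" if "dist L K < e" for L
    unfolding D_stab_def
  proof (rule CollectI, rule spectral_radius_less_1_of_lyapunov[where P = ?P])
    show "0 \<le> v \<bullet> (?P *v v)" for v using Pt_sol_ge[OF K, of v] inner_ge_zero[of v] by linarith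
    fix v :: "real ^ 'n" assume v: "v \<noteq> 0"
    have SK: "S K = mat 1" unfolding S_def by (rule Pt_sol_stein[OF K])
    \<comment> \<open>\<open>S K\<close> is the identity, and a matrix at Frobenius distance less
      than 1 from the identity still has a positive quadratic form.\<close>
    have "\<bar>v \<bullet> ((S L - S K) *v v)\<bar> \<le> norm v * (norm (S L - S K) * norm v)"
      by (rule order.trans[OF Cauchy_Schwarz_ineq2]) (intro mult_left_mono norm_matrix_vector_mult_le norm_ge_zero)
    also have "\<dots> = norm (S L - S K) * (v \<bullet> v)"
      by (simp add: power2_norm_eq_inner[symmetric] power2_eq_square)
    also have "\<dots> < 1 * (v \<bullet> v)"
      using e(2)[OF that] v by (intro mult_strict_right_mono) (auto simp: dist_norm)
    finally have "v \<bullet> (S L *v v) > 0"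
      unfolding SK by (simp add: matrix_vector_mult_diff_rdistrib inner_diff_right)
    then show "(closed_loop A B L *v v) \<bullet> (?P *v (closed_loop A B L *v v)) < v \<bullet> (?P *v v)"
      unfolding S_def inner_stein by simp
  qed
  then show "\<exists>e>0. \<forall>L. dist L K < e \<longrightarrow> L \<in> D_stab A B" using e(1) by blast
qed

lemma C11_at_transpose:
  "C11_at (\<lambda>K. M K $ j $ i) a \<Longrightarrow> C11_at (\<lambda>K. transpose (M K) $ i $ j) a"
  by (simp add: transpose_def)

lemmas C11_at_matrix_intros =
  C11_at_add C11_at_mult C11_at_const C11_at_matrix_mult C11_at_transpose C11_at_entry C11_at_closed_loop

lemma pos_defD:
  assumes "pos_def M" shows "transpose M = M" "v \<bullet> (M *v v) \<ge> 0"
  using assms unfolding pos_def_def by (auto simp: le_less) (metis inner_zero_left)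

lemma eventually_D_stab:
  "K \<in> D_stab A B \<Longrightarrow> \<forall>\<^sub>F L in nhds K. L \<in> D_stab A B"
  by (rule eventually_nhds_in_open[OF open_D_stab])

section \<open>Regularity, coercivity and compact sublevel sets of the objective\<close>

context
  fixes A Q \<Sigma> :: "real ^ 'n ^ 'n" and B :: "real ^ 'm ^ 'n" and R :: "real ^ 'm ^ 'm"
    and x :: "real ^ 'n" and \<gamma> \<alpha> \<mu> :: real
  assumes Q: "pos_def Q" and R: "pos_def R" and \<Sigma>: "pos_def \<Sigma>"
    and \<gamma>: "0 < \<gamma>" "\<gamma> < 1" and \<alpha>: "0 \<le> \<alpha>" and \<mu>: "0 < \<mu>"
begin

lemma C11_at_P: assumes "K \<in> D_stab A B" shows "C11_at (\<lambda>L. P_sol A B Q R \<gamma> L $ i $ j) K"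
proof (rule C11_at_stein_solution[where s = \<gamma> and F = "closed_loop A B" and C = "\<lambda>L. Q + transpose L ** R ** L"])
  show "\<forall>\<^sub>F L in nhds K. power_null (closed_loop A B L) \<and> stein \<gamma> (closed_loop A B L) (P_sol A B Q R \<gamma> L) = Q + transpose L ** R ** L"
    using eventually_D_stab[OF assms] by eventually_elim (use \<gamma> D_stab_power_null P_sol_stein in blast)
  show "C11_at (\<lambda>L. (Q + transpose L ** R ** L) $ i $ j) K" for i j
    by (simp only: vector_add_component, intro C11_at_matrix_intros)
qed (use \<gamma> C11_at_closed_loop in auto)

lemma C11_at_Z: assumes "K \<in> D_stab A B" shows "C11_at (\<lambda>L. Z_sol A B \<Sigma> x \<gamma> L $ i $ j) K"
proof (rule C11_at_stein_solution[where s = "\<gamma>\<^sup>2" and F = "\<lambda>L. transpose (closed_loop A B L)"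
      and C = "\<lambda>L. closed_loop A B L ** (outer x + (\<gamma>\<^sup>2 / (1 - \<gamma>\<^sup>2)) *\<^sub>R \<Sigma>) ** transpose (closed_loop A B L)"])
  show "\<forall>\<^sub>F L in nhds K. power_null (transpose (closed_loop A B L)) \<and>
      stein (\<gamma>\<^sup>2) (transpose (closed_loop A B L)) (Z_sol A B \<Sigma> x \<gamma> L) =
      closed_loop A B L ** (outer x + (\<gamma>\<^sup>2 / (1 - \<gamma>\<^sup>2)) *\<^sub>R \<Sigma>) ** transpose (closed_loop A B L)"
    using eventually_D_stab[OF assms]
    by eventually_elim (use \<gamma> D_stab_power_null power_null_transpose Z_sol_stein in blast)
  show "\<gamma>\<^sup>2 \<le> 1" using \<gamma> by (simp add: power_le_one)
qed (intro C11_at_matrix_intros zero_le_power2)+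

lemma C11_at_Pt: assumes "K \<in> D_stab A B" shows "C11_at (\<lambda>L. Pt_sol A B L $ i $ j) K"
proof (rule C11_at_stein_solution[where s = 1 and F = "closed_loop A B" and C = "\<lambda>L. mat 1"])
  show "\<forall>\<^sub>F L in nhds K. power_null (closed_loop A B L) \<and> stein 1 (closed_loop A B L) (Pt_sol A B L) = mat 1"
    using eventually_D_stab[OF assms] by eventually_elim (use D_stab_power_null Pt_sol_stein in blast)
qed (use C11_at_closed_loop C11_at_const in auto)

lemma C11_at_f: assumes "K \<in> D_stab A B" shows "C11_at (\<lambda>L. J A B Q R \<Sigma> x \<gamma> \<alpha> L + \<mu> * ln (det (Pt_sol A B L))) K"
proof -
  have "C11_at (\<lambda>L. x \<bullet> (P_sol A B Q R \<gamma> L *v x)) K"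
    unfolding inner_vec_def matrix_vector_mult_def inner_real_def vec_lambda_beta
    by (intro C11_at_sum C11_at_mult C11_at_const C11_at_P assms)
  moreover have "C11_at (\<lambda>L. ln (det (Pt_sol A B L))) K"
    using det_Pt_sol_ge_1[OF assms]
    by (intro C11_at_compose[of _ K ln] C11_at_det C11_at_Pt assms C11_at_ln_real) simp
  ultimately show ?thesis
    unfolding J_def Let_def
    by (intro C11_at_add C11_at_mult C11_at_const C11_at_trace C11_at_matrix_mult C11_at_P C11_at_Z assms)
qed

text \<open>The growth comes from tr(P\<Sigma>) alone: P dominates K^T R K, \<Sigma> dominates s I
  and R dominates r I. The remaining terms are nonnegative, being a quadratic form of P or traces of
  products of two positive semidefinite matrices.\<close>

lemma J_coercive:
  obtains c where "c > 0" "\<And>K. K \<in> D_stab A B \<Longrightarrow> J A B Q R \<Sigma> x \<gamma> \<alpha> K \<ge> c * (norm K)\<^sup>2"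
proof -
  obtain r where r: "r > 0" "\<And>v. v \<bullet> (R *v v) \<ge> r * (v \<bullet> v)" by (rule pos_def_coercive[OF R]) blast
  obtain s where s: "s > 0" "\<And>v. v \<bullet> (\<Sigma> *v v) \<ge> s * (v \<bullet> v)" by (rule pos_def_coercive[OF \<Sigma>]) blast
  have \<gamma>2: "\<gamma>\<^sup>2 < 1" using \<gamma> by (simp add: power_less_one_iff)
  show ?thesis
  proof (rule that[of "\<gamma> / (1 - \<gamma>) * (s * r)"])
    show "\<gamma> / (1 - \<gamma>) * (s * r) > 0" using \<gamma> r s by simp
    fix K assume K: "K \<in> D_stab A B"
    note pn = D_stab_power_null[OF K]
    let ?F = "closed_loop A B K" and ?P = "P_sol A B Q R \<gamma> K" and ?Z = "Z_sol A B \<Sigma> x \<gamma> K" and ?N = "transpose K ** R ** K"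
    have Nsym: "transpose ?N = ?N"
      by (simp add: matrix_transpose_mul pos_defD(1)[OF R] matrix_mul_assoc)
    have C: "v \<bullet> ((Q + ?N) *v v) \<ge> v \<bullet> (?N *v v)" "v \<bullet> (?N *v v) \<ge> 0" for v
      unfolding matrix_vector_mult_add_rdistrib inner_add_right inner_congruence
      using pos_defD(2)[OF Q, of v] pos_defD(2)[OF R, of "K *v v"] by auto
    have P_ge: "v \<bullet> (?P *v v) \<ge> v \<bullet> ((Q + ?N) *v v)" for v
      by (rule stein_psd[OF pn _ _ P_sol_stein[OF K \<gamma>]]) (use \<gamma> order.trans[OF C(2) C(1)] in auto)
    have Psym: "transpose ?P = ?P"
      by (rule stein_symmetric[OF pn _ _ P_sol_stein[OF K \<gamma>]])
        (use \<gamma> in \<open>simp_all add: transpose_add Nsym pos_defD(1)[OF Q]\<close>)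
    let ?W = "outer x + (\<gamma>\<^sup>2 / (1 - \<gamma>\<^sup>2)) *\<^sub>R \<Sigma>"
    have Wsym: "transpose ?W = ?W"
      by (simp add: transpose_add transpose_scaleR pos_defD(1)[OF \<Sigma>])
        (simp add: transpose_def outer_def vec_eq_iff mult.commute)
    have outer: "outer x *v v = (x \<bullet> v) *\<^sub>R x" for v
      by (rule outer_mult_vector)
    have W: "v \<bullet> (?W *v v) \<ge> 0" for v
      using pos_defD(2)[OF \<Sigma>, of v] \<gamma>2
      by (simp add: matrix_vector_mult_add_rdistrib scaleR_matrix_vector_assoc[symmetric] outer inner_add_right inner_commute[of v x])
    have Zsym: "transpose ?Z = ?Z"
      by (rule stein_symmetric[OF power_null_transpose[OF pn] _ _ Z_sol_stein[OF K \<gamma>]])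
        (use \<gamma>2 Wsym in \<open>simp_all add: matrix_transpose_mul matrix_mul_assoc\<close>)
    have FW: "v \<bullet> ((?F ** ?W ** transpose ?F) *v v) \<ge> 0" for v
      using inner_congruence[of v "transpose ?F" ?W v] W by simp
    have Z: "v \<bullet> (?Z *v v) \<ge> 0" for v
      by (rule order.trans[OF FW stein_psd[OF power_null_transpose[OF pn] _ _ Z_sol_stein[OF K \<gamma>]]])
        (use \<gamma>2 FW in auto)
    \<comment> \<open>Grouping three factors as a congruence of \<Sigma> turns both remaining traces
      into products of two positive semidefinite matrices.\<close>
    have P\<Sigma>P: "v \<bullet> ((?P ** \<Sigma> ** ?P) *v v) \<ge> 0" for v
      using inner_congruence[of v ?P \<Sigma> v] pos_defD(2)[OF \<Sigma>] Psym by simp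
    have "trace ((?P - ?N) ** \<Sigma>) \<ge> 0"
      by (rule trace_mult_psd_nonneg[OF _ pos_defD[OF \<Sigma>]])
        (use order.trans[OF C(1) P_ge] in \<open>simp add: matrix_vector_mult_diff_rdistrib inner_diff_right\<close>)
    moreover have "trace ((?P - ?N) ** \<Sigma>) = trace (?P ** \<Sigma>) - trace (?N ** \<Sigma>)"
      by (simp add: trace_def matrix_matrix_mult_def sum_subtractf left_diff_distrib)
    moreover have "trace (?N ** (\<Sigma> - s *\<^sub>R mat 1)) \<ge> 0"
      by (rule trace_mult_psd_nonneg[OF C(2)])
        (use s(2) in \<open>simp_all add: transpose_diff transpose_scaleR pos_defD(1)[OF \<Sigma>] transpose_mat
           matrix_vector_mult_diff_rdistrib scaleR_matrix_vector_assoc[symmetric] inner_diff_right\<close>)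
    moreover have "trace (?N ** (\<Sigma> - s *\<^sub>R mat 1)) = trace (?N ** \<Sigma>) - s * trace ?N"
    proof -
      have "?N ** (\<Sigma> - s *\<^sub>R mat 1) = ?N ** \<Sigma> - s *\<^sub>R (?N ** mat 1)"
        by (simp only: vec_eq_iff matrix_matrix_mult_def)
          (simp add: sum_subtractf right_diff_distrib sum_distrib_left mult.left_commute)
      then show ?thesis by (simp add: trace_def sum_subtractf sum_distrib_left)
    qed
    moreover have "s * trace ?N \<ge> s * (r * (norm K)\<^sup>2)"
      using s(1) trace_congruence_ge[OF r(2)] by (intro mult_left_mono) auto
    ultimately have "trace (?P ** \<Sigma>) \<ge> s * r * (norm K)\<^sup>2" by simp
    then have 1: "\<gamma> / (1 - \<gamma>) * trace (?P ** \<Sigma>) \<ge> \<gamma> / (1 - \<gamma>) * (s * r) * (norm K)\<^sup>2"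
      using \<gamma> mult_left_mono[of "s * r * (norm K)\<^sup>2" _ "\<gamma> / (1 - \<gamma>)"] by (simp add: mult.assoc)
    have 2: "2 * \<alpha> * \<gamma>\<^sup>2 / (1 - \<gamma>\<^sup>2) * trace (?P ** \<Sigma> ** ?P ** \<Sigma>) \<ge> 0"
      using \<alpha> \<gamma>2 trace_mult_psd_nonneg[OF P\<Sigma>P pos_defD[OF \<Sigma>]] by (intro mult_nonneg_nonneg) auto
    have 3: "4 * \<alpha> * \<gamma>\<^sup>2 * trace (?P ** \<Sigma> ** ?P ** ?Z) \<ge> 0"
      using \<alpha> trace_mult_psd_nonneg[OF P\<Sigma>P Zsym Z] by (intro mult_nonneg_nonneg) auto
    have 4: "x \<bullet> (?P *v x) \<ge> 0" using P_ge[of x] C[of x] by linarith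
    show "J A B Q R \<Sigma> x \<gamma> \<alpha> K \<ge> \<gamma> / (1 - \<gamma>) * (s * r) * (norm K)\<^sup>2"
      unfolding J_def Let_def using 1 2 3 4 by linarith
  qed
qed

text \<open>A bound on the objective bounds \<open>K\<close> by coercivity and \<open>Pt_sol A B K\<close> through its determinant. Limits of
  such pairs still solve the Lyapunov equation, so they stay in the stable region.\<close>

lemma compact_sublevel:
  "compact {K \<in> D_stab A B. J A B Q R \<Sigma> x \<gamma> \<alpha> K + \<mu> * ln (det (Pt_sol A B K)) \<le> M}"
proof -
  let ?f = "\<lambda>K. J A B Q R \<Sigma> x \<gamma> \<alpha> K + \<mu> * ln (det (Pt_sol A B K))"
  obtain c where c: "c > 0" "\<And>K. K \<in> D_stab A B \<Longrightarrow> J A B Q R \<Sigma> x \<gamma> \<alpha> K \<ge> c * (norm K)\<^sup>2"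
    by (rule J_coercive) blast
  \<comment> \<open>Pairs of a gain and a Lyapunov certificate. The first radius comes from
    coercivity; the second from bounding each of the n^2 entries of \<open>Pt_sol\<close> by
    exp(M/\<mu>).\<close>
  define T where "T = {p. stein 1 (closed_loop A B (fst p)) (snd p) = mat 1} \<inter>
    {p. \<forall>v. v \<bullet> v \<le> v \<bullet> (snd p *v v)} \<inter>
    (cball 0 (sqrt (M / c)) \<times> cball 0 (sqrt (CARD('n) * (CARD('n) * (exp (M / \<mu>))\<^sup>2))))"
  have "closed {p. stein 1 (closed_loop A B (fst p)) (snd p) = mat 1}"
    by (intro closed_Collect_eq continuous_on_const continuous_at_imp_continuous_on ballI isCont_stein_closed_loop)
  moreover have "closed {p :: (real ^ 'n ^ 'm) \<times> (real ^ 'n ^ 'n). \<forall>v. v \<bullet> v \<le> v \<bullet> (snd p *v v)}"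
    unfolding matrix_vector_mult_def inner_vec_def
      vec_lambda_beta inner_real_def
    by (intro closed_Collect_all closed_Collect_le continuous_intros continuous_on_component)
  ultimately have "compact T"
    unfolding T_def by (intro closed_Int_compact closed_Int compact_Times compact_cball)
  then have cT: "compact (fst ` T)" by (intro compact_continuous_image continuous_intros)
  have TD: "fst ` T \<subseteq> D_stab A B" unfolding T_def by (auto intro: D_stabI)
  have sub: "K \<in> fst ` T" if K: "K \<in> D_stab A B" "?f K \<le> M" for K
  proof -
    let ?P = "Pt_sol A B K"
    have d1: "det ?P \<ge> 1" by (rule det_Pt_sol_ge_1[OF K(1)])
    then have ln: "ln (det ?P) \<ge> 0" by simp
    have "c * (norm K)\<^sup>2 \<le> M" using c(2)[OF K(1)] K(2) mult_nonneg_nonneg[of \<mu>, OF _ ln] \<mu> by linarith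
    then have "(norm K)\<^sup>2 \<le> M / c" using c(1) by (simp add: pos_le_divide_eq mult.commute)
    then have nK: "norm K \<le> sqrt (M / c)" by (rule real_le_rsqrt)
    have "J A B Q R \<Sigma> x \<gamma> \<alpha> K \<ge> 0" using c(2)[OF K(1)] c(1) by (meson order.trans mult_nonneg_nonneg zero_le_power2 less_imp_le)
    then have "\<mu> * ln (det ?P) \<le> M" using K(2) by linarith
    then have "ln (det ?P) \<le> M / \<mu>" using \<mu> by (simp add: pos_le_divide_eq mult.commute)
    then have det: "det ?P \<le> exp (M / \<mu>)" using d1 by (metis exp_le_cancel_iff exp_ln less_le_trans zero_less_one)
    have diag: "?P $ i $ i \<le> exp (M / \<mu>)" for i
      using det_ge_diagonal(1)[OF Pt_sol_ge[OF K(1)], of i] det by linarith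
    have psd: "v \<bullet> (?P *v v) \<ge> 0" for v using Pt_sol_ge[OF K(1), of v] inner_ge_zero[of v] by linarith
    have "\<bar>?P $ i $ j\<bar> \<le> exp (M / \<mu>)" for i j
      using psd_entry_bound[OF Pt_sol_symmetric[OF K(1)] psd, of i j] diag[of i] diag[of j] by linarith
    then have "(?P $ i $ j)\<^sup>2 \<le> (exp (M / \<mu>))\<^sup>2" for i j
      by (metis abs_ge_zero power2_abs power_mono)
    then have "(norm ?P)\<^sup>2 \<le> (\<Sum>i\<in>(UNIV :: 'n set). \<Sum>j\<in>(UNIV :: 'n set). (exp (M / \<mu>))\<^sup>2)"
      unfolding norm_matrix_squared by (intro sum_mono)
    then have "(norm ?P)\<^sup>2 \<le> CARD('n) * (CARD('n) * (exp (M / \<mu>))\<^sup>2)" by simp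
    then have "norm ?P \<le> sqrt (CARD('n) * (CARD('n) * (exp (M / \<mu>))\<^sup>2))" by (rule real_le_rsqrt)
    then have "(K, ?P) \<in> T"
      unfolding T_def using nK Pt_sol_stein[OF K(1)] Pt_sol_ge[OF K(1)] by simp
    then show ?thesis by force
  qed
  \<comment> \<open>Continuity of the objective is known only on the open stable region; the compact
    projection lies inside it and contains the sublevel set, so closedness can be checked
    there.\<close>
  have "continuous_on (fst ` T) ?f"
    using TD C11_at_f C11_at_isCont by (intro continuous_at_imp_continuous_on) blast
  then have "closed (fst ` T \<inter> ?f -` {..M})"
    by (rule continuous_closed_preimage[OF _ compact_imp_closed[OF cT]]) simp
  with cT have "compact (fst ` T \<inter> (fst ` T \<inter> ?f -` {..M}))" by (rule compact_Int_closed)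
  moreover have "{K \<in> D_stab A B. ?f K \<le> M} = fst ` T \<inter> (fst ` T \<inter> ?f -` {..M})"
    using sub TD by auto
  ultimately show ?thesis by simp
qed

end

theorem theorem3:
  fixes A Q \<Sigma> :: "real ^ 'n ^ 'n" and B :: "real ^ 'm ^ 'n" and R :: "real ^ 'm ^ 'm"
    and x :: "real ^ 'n" and \<gamma> \<alpha> \<mu> \<beta> \<tau> \<eta>\<^sub>0 :: real
    and K\<^sub>0 :: "real ^ 'n ^ 'm" and K :: "nat \<Rightarrow> real ^ 'n ^ 'm" and \<eta> :: "nat \<Rightarrow> real"
  defines "J\<^sub>\<mu> \<equiv> J_pen A B Q R \<Sigma> x \<gamma> \<alpha> \<mu>"
    and "G \<equiv> grad_J_pen A B Q R \<Sigma> x \<gamma> \<alpha> \<mu>"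
  defines "S\<^sub>0 \<equiv> {L. J\<^sub>\<mu> L \<le> J\<^sub>\<mu> K\<^sub>0}"
  assumes "pos_def Q" and "pos_def R" and "pos_def \<Sigma>"
    and "0 < \<gamma>" and "\<gamma> < 1" and "0 \<le> \<alpha>" and "0 < \<mu>"
    and "K\<^sub>0 \<in> D_stab A B"
    and "0 < \<beta>" and "\<beta> < 1" and "0 < \<tau>" and "\<tau> < 1" and "0 < \<eta>\<^sub>0"
    and "K 0 = K\<^sub>0"
    and "\<And>k. \<eta> k = backtrack J\<^sub>\<mu> G \<tau> \<eta>\<^sub>0 \<beta> (K k)"
    and "\<And>k. K (Suc k) = K k - \<eta> k *\<^sub>R G (K k)"
  shows "(\<forall>k. \<exists>j. armijo J\<^sub>\<mu> G \<tau> (K k) (\<eta>\<^sub>0 * \<beta> ^ j)) \<and>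
    (\<exists>\<eta>\<^sub>m\<^sub>i\<^sub>n > 0.
       (\<forall>k. K k \<in> S\<^sub>0) \<and> S\<^sub>0 \<subseteq> D_stab A B \<and>
       (\<forall>k. \<eta> k \<ge> \<eta>\<^sub>m\<^sub>i\<^sub>n) \<and>
       (\<lambda>k. norm (G (K k))) \<longlonglongrightarrow> 0 \<and>
       (\<forall>N. ereal (Min ((\<lambda>k. (norm (G (K k)))\<^sup>2) ` {0..N}))
              \<le> (J\<^sub>\<mu> K\<^sub>0 - (INF L\<in>S\<^sub>0. J\<^sub>\<mu> L)) / ereal (\<tau> * \<eta>\<^sub>m\<^sub>i\<^sub>n * (real N + 1))) \<and>
       (\<lambda>N. Min ((\<lambda>k. (norm (G (K k)))\<^sup>2) ` {0..N})) \<in> O(\<lambda>N. 1 / real N))"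
proof -
  let ?D = "D_stab A B"
  let ?f = "\<lambda>L. J A B Q R \<Sigma> x \<gamma> \<alpha> L + \<mu> * ln (det (Pt_sol A B L))"
  have G: "G = gradient (\<lambda>L. real_of_ereal (J\<^sub>\<mu> L))"
    unfolding G_def J\<^sub>\<mu>_def grad_J_pen_def by (rule ext) simp
  have in_D: "J\<^sub>\<mu> L = ereal (?f L)" if "L \<in> ?D" for L
    using that unfolding J\<^sub>\<mu>_def J_pen_def by simp
  have notin_D: "J\<^sub>\<mu> L = \<infinity>" if "L \<notin> ?D" for L
    using that unfolding J\<^sub>\<mu>_def J_pen_def by simp
  have K0: "K 0 \<in> ?D" using assms by simp
  \<comment> \<open>Openness of the stable region makes the real value assigned to \<infinity>
    irrelevant near a stabilizing gain.\<close>
  have C11: "C11_at (\<lambda>L. real_of_ereal (J\<^sub>\<mu> L)) L" if "L \<in> ?D" for L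
  proof (rule C11_at_cong[where g = ?f])
    show "\<forall>\<^sub>F L in nhds L. real_of_ereal (J\<^sub>\<mu> L) = ?f L"
      using eventually_nhds_in_open[OF open_D_stab that] by eventually_elim (simp add: in_D)
    show "C11_at ?f L" by (rule C11_at_f) (use assms that in auto)
  qed
  have "{L. J\<^sub>\<mu> L \<le> J\<^sub>\<mu> (K 0)} = {L \<in> ?D. ?f L \<le> ?f (K 0)}"
  proof (intro Collect_cong)
    fix L show "J\<^sub>\<mu> L \<le> J\<^sub>\<mu> (K 0) \<longleftrightarrow> L \<in> ?D \<and> ?f L \<le> ?f (K 0)"
      unfolding in_D[OF K0] by (cases "L \<in> ?D") (simp_all add: in_D notin_D)
  qed
  moreover have "compact {L \<in> ?D. ?f L \<le> ?f (K 0)}"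
    by (rule compact_sublevel) (use assms in auto)
  ultimately have S: "compact {L. J\<^sub>\<mu> L \<le> J\<^sub>\<mu> (K 0)}" by simp
  have "J\<^sub>\<mu> L = ereal (real_of_ereal (J\<^sub>\<mu> L))" if "L \<in> ?D" for L using in_D[OF that] by simp
  from armijo_descent[of ?D J\<^sub>\<mu> K \<beta> \<tau> \<eta>\<^sub>0 \<eta>, OF this notin_D open_D_stab C11 S K0] assms(12-16,18,19)
  show ?thesis unfolding S\<^sub>0_def \<open>K 0 = K\<^sub>0\<close>[symmetric] G by blast
qed

end
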